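(* Let $\Gamma$ be an antipodal tight graph $\mathrm{AT4}(p,q,r)$. Then $$r\leq\frac{p+q^3}{p+q}.$$ If equality holds, then the $\mu$-graph of $\Gamma$ (that is, the $\mu(x,y)$-graph for any two vertices $x,y$ of $\Gamma$ at distance $2$) is strongly regular with parameters $$\left(\frac{q(p+q)}{r},\ p,\ (q-1)(q-2)+\frac{2(p-1)}{q+1},\ \frac{p+q^3}{q+1}\right).$$
   Context: All graphs are finite and simple. A connected graph $\Gamma$ of diameter $d$ with distance function $\partial$ is distance-regular if for all $0\le i\le d$ and all vertices $x,y$ with $\partial(x,y)=i$ the numbers $a_i=|\Gamma_i(x)\cap\Gamma_1(y)|$, $b_i=|\Gamma_{i+1}(x)\cap\Gamma_1(y)|$, $c_i=|\Gamma_{i-1}(x)\cap\Gamma_1(y)|$ depend only on $i$, where $\Gamma_i(x)=\{y:\partial(x,y)=i\}$. Its valency is $k=b_0$. A $k$-regular graph on $n$ vertices is strongly regular with parameters $(n,k,a,c)$ if each pair of adjacent vertices has exactly $a$ common neighbors and each pair of distinct non-adjacent vertices has exactly $c$ common neighbors. The local graph of $\Gamma$ at $x$ is the subgraph induced on $\Gamma_1(x)$. For vertices $x,y$ with $\partial(x,y)=2$, the $\mu(x,y)$-graph is the subgraph of $\Gamma$ induced on $\Gamma_1(x)\cap\Gamma_1(y)$. Tight: let $\Gamma$ be distance-regular with diameter $d\ge3$ and eigenvalues $k=\theta_0>\theta_1>\dots>\theta_d$. Then $\Gamma$ is tight if it is not bipartite and $$\Big(\theta_1+\tfrac{k}{a_1+1}\Big)\Big(\theta_d+\tfrac{k}{a_1+1}\Big)=-\tfrac{ka_1b_1}{(a_1+1)^2}.$$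 It is known that if $\Gamma$ is tight then every local graph is connected strongly regular with nontrivial eigenvalues (those other than the valency) $-1-b_1/(1+\theta_d)$ and $-1-b_1/(1+\theta_1)$. Antipodal: $\Gamma$ of diameter $d$ is antipodal if $\partial(x,y)=\partial(x,z)=d$ implies $y=z$ or $\partial(y,z)=d$; then being at distance $0$ or $d$ is an equivalence relation, whose classes are the antipodal classes, and $\Gamma$ is an antipodal $r$-cover if all classes have size $r$. An antipodal tight graph $\mathrm{AT4}(p,q,r)$ is a tight distance-regular graph of diameter $4$ that is an antipodal $r$-cover and whose local graphs have nontrivial eigenvalues $p$ and $-q$ with $p>-q$. It is known that then $p,q,r$ are integers with $p\ge1$, $q\ge2$, $r\ge2$, and that $\Gamma$ has intersection array $\{b_0,b_1,b_2,b_3;c_1,c_2,c_3,c_4\}=\{q(pq+p+q),(q^2-1)(p+1),(r-1)q(p+q)/r,1;\ 1,q(p+q)/r,(q^2-1)(p+1),q(pq+p+q)\}$. *)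

theory Defs
  imports Complex_Main "Graph_Theory.Digraph_Component"
begin

text \<open>Finite simple graphs are represented by the locale predicate \<^const>\<open>pair_graph\<close>:
  each edge is a pair of opposite arcs.\<close>

definition induced_graph :: "'a pair_pre_digraph \<Rightarrow> 'a set \<Rightarrow> 'a pair_pre_digraph" where
  "induced_graph G S = \<lparr> pverts = pverts G \<inter> S, parcs = parcs G \<inter> (S \<times> S) \<rparr>"

text \<open>The length of a shortest walk; meaningful for vertices joined by a walk, in particular
  for all pairs of vertices of a connected graph.\<close>

definition gdist :: "'a pair_pre_digraph \<Rightarrow> 'a \<Rightarrow> 'a \<Rightarrow> nat" where
  "gdist G x y = (LEAST n. \<exists>w. pre_digraph.awalk (with_proj G) x w y \<and> length w = n)"

definition diameter :: "'a pair_pre_digraph \<Rightarrow> nat" where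
  "diameter G = Max {gdist G x y | x y. x \<in> pverts G \<and> y \<in> pverts G}"

definition at_dist :: "'a pair_pre_digraph \<Rightarrow> nat \<Rightarrow> 'a \<Rightarrow> 'a set" where
  "at_dist G i x = {y \<in> pverts G. gdist G x y = i}"

definition local_graph :: "'a pair_pre_digraph \<Rightarrow> 'a \<Rightarrow> 'a pair_pre_digraph" where
  "local_graph G x = induced_graph G (at_dist G 1 x)"

definition mu_graph :: "'a pair_pre_digraph \<Rightarrow> 'a \<Rightarrow> 'a \<Rightarrow> 'a pair_pre_digraph" where
  "mu_graph G x y = induced_graph G (at_dist G 1 x \<inter> at_dist G 1 y)"

definition regular_graph :: "'a pair_pre_digraph \<Rightarrow> nat \<Rightarrow> bool" where
  "regular_graph G k \<longleftrightarrow>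
     pair_graph G \<and> (\<forall>x \<in> pverts G. card {y \<in> pverts G. (x, y) \<in> parcs G} = k)"

definition strongly_regular ::
  "'a pair_pre_digraph \<Rightarrow> nat \<Rightarrow> nat \<Rightarrow> nat \<Rightarrow> nat \<Rightarrow> bool" where
  "strongly_regular G n k a c \<longleftrightarrow>
     regular_graph G k \<and> card (pverts G) = n \<and>
     (\<forall>x \<in> pverts G. \<forall>y \<in> pverts G. (x, y) \<in> parcs G \<longrightarrow>
        card {z \<in> pverts G. (x, z) \<in> parcs G \<and> (y, z) \<in> parcs G} = a) \<and>
     (\<forall>x \<in> pverts G. \<forall>y \<in> pverts G. x \<noteq> y \<and> (x, y) \<notin> parcs G \<longrightarrow>
        card {z \<in> pverts G. (x, z) \<in> parcs G \<and> (y, z) \<in> parcs G} = c)"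

text \<open>In \<open>distance_regular G a b c\<close> the functions \<open>a\<close>, \<open>b\<close>, \<open>c\<close> give the intersection numbers;
  their values above the diameter are irrelevant.  For \<open>i = 0\<close> the truncated \<open>i - 1\<close> is harmless:
  no vertex is both at distance 0 from \<open>x\<close> and adjacent to \<open>x\<close>, so \<open>c 0 = 0\<close> as it should be.\<close>

definition distance_regular ::
  "'a pair_pre_digraph \<Rightarrow> (nat \<Rightarrow> nat) \<Rightarrow> (nat \<Rightarrow> nat) \<Rightarrow> (nat \<Rightarrow> nat) \<Rightarrow> bool" where
  "distance_regular G a b c \<longleftrightarrow>
     pair_graph G \<and> Digraph_Component.connected (with_proj G) \<and>
     (\<forall>i \<le> diameter G. \<forall>x \<in> pverts G. \<forall>y \<in> pverts G. gdist G x y = i \<longrightarrow>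
        card (at_dist G i x \<inter> at_dist G 1 y) = a i \<and>
        card (at_dist G (i + 1) x \<inter> at_dist G 1 y) = b i \<and>
        card (at_dist G (i - 1) x \<inter> at_dist G 1 y) = c i)"

text \<open>The matrix is indexed by the vertices themselves.  It is real symmetric, so its eigenvalues
  are all real and real eigenvectors suffice.\<close>

definition adjacency :: "'a pair_pre_digraph \<Rightarrow> 'a \<Rightarrow> 'a \<Rightarrow> real" where
  "adjacency G x y = (if (x, y) \<in> parcs G then 1 else 0)"

definition eigenvalues :: "'a pair_pre_digraph \<Rightarrow> real set" where
  "eigenvalues G =
     {\<theta>. \<exists>f :: 'a \<Rightarrow> real. (\<exists>x \<in> pverts G. f x \<noteq> 0) \<and>
          (\<forall>x \<in> pverts G. (\<Sum>y \<in> pverts G. adjacency G x y * f y) = \<theta> * f x)}"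

definition nontrivial_eigenvalues :: "'a pair_pre_digraph \<Rightarrow> real set \<Rightarrow> bool" where
  "nontrivial_eigenvalues G S \<longleftrightarrow>
     (\<exists>k. regular_graph G k \<and> eigenvalues G - {real k} = S)"

definition bipartite :: "'a pair_pre_digraph \<Rightarrow> bool" where
  "bipartite G \<longleftrightarrow>
     (\<exists>U W. pverts G = U \<union> W \<and> U \<inter> W = {} \<and> parcs G \<subseteq> U \<times> W \<union> W \<times> U)"

definition tight :: "'a pair_pre_digraph \<Rightarrow> bool" where
  "tight G \<longleftrightarrow>
     (\<exists>a b c d k. \<exists>\<theta> :: nat \<Rightarrow> real.
        distance_regular G a b c \<and> d = diameter G \<and> 3 \<le> d \<and> k = real (b 0) \<and>
        strict_antimono_on {..d} \<theta> \<and> eigenvalues G = \<theta> ` {..d} \<and> \<theta> 0 = k \<and>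
        \<not> bipartite G \<and>
        (\<theta> 1 + k / (real (a 1) + 1)) * (\<theta> d + k / (real (a 1) + 1)) =
          - (k * real (a 1) * real (b 1) / (real (a 1) + 1)\<^sup>2))"

definition antipodal :: "'a pair_pre_digraph \<Rightarrow> bool" where
  "antipodal G \<longleftrightarrow>
     (\<forall>x \<in> pverts G. \<forall>y \<in> pverts G. \<forall>z \<in> pverts G.
        gdist G x y = diameter G \<and> gdist G x z = diameter G \<longrightarrow>
        y = z \<or> gdist G y z = diameter G)"

definition antipodal_rel :: "'a pair_pre_digraph \<Rightarrow> 'a rel" where
  "antipodal_rel G =
     {(x, y). x \<in> pverts G \<and> y \<in> pverts G \<and> (gdist G x y = 0 \<or> gdist G x y = diameter G)}"

definition antipodal_cover :: "'a pair_pre_digraph \<Rightarrow> nat \<Rightarrow> bool" where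
  "antipodal_cover G r \<longleftrightarrow>
     antipodal G \<and> (\<forall>C \<in> pverts G // antipodal_rel G. card C = r)"

text \<open>Only \<open>p > -q\<close> is required of the real numbers \<open>p\<close> and \<open>q\<close>; that \<open>p\<close>, \<open>q\<close> are integers with
  \<open>p \<ge> 1\<close>, \<open>q \<ge> 2\<close>, that \<open>r \<ge> 2\<close>, and the intersection array are consequences of the definition.\<close>

definition AT4 :: "'a pair_pre_digraph \<Rightarrow> real \<Rightarrow> real \<Rightarrow> nat \<Rightarrow> bool" where
  "AT4 G p q r \<longleftrightarrow>
     tight G \<and> diameter G = 4 \<and> antipodal_cover G r \<and> p > - q \<and>
     (\<forall>x \<in> pverts G. nontrivial_eigenvalues (local_graph G x) {p, - q})"

end

theory Submission
  imports Defs
begin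

text \<open>
  Let \<open>x\<close> and \<open>y\<close> be at distance \<open>2\<close>, let \<open>\<Delta>\<close> be the local graph at \<open>x\<close>, and let
  \<open>y = y\<^sub>1, \<dots>, y\<^sub>r\<close> be the antipodal class of \<open>y\<close>.  All \<open>y\<^sub>i\<close> are at distance \<open>2\<close> from \<open>x\<close>, so \<open>\<Delta>\<close>
  contains \<open>r\<close> pairwise disjoint \<open>\<mu>\<close>-graphs \<open>M\<^sub>i\<close>, with no edges between different ones because the
  \<open>y\<^sub>i\<close> are at mutual distance \<open>4\<close>.  The \<open>M\<^sub>i\<close> and the set of remaining vertices of \<open>\<Delta>\<close> form an
  equitable partition of \<open>\<Delta>\<close>, which is strongly regular with nontrivial eigenvalues \<open>p\<close> and \<open>-q\<close>.

  The bound compares ranks.  Let \<open>R\<close> be \<open>p + q\<close> times the projection onto those \<open>p\<close>-eigenvectors of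
  \<open>\<Delta>\<close> that are orthogonal to the characteristic vectors of the parts, and let \<open>P\<close> be the restriction to
  the union of the \<open>M\<^sub>i\<close>.  Then \<open>P R P\<close> is block diagonal, and on \<open>M\<^sub>i\<close> it is
  \<open>A(M\<^sub>i) + q I\<close> up to a multiple of the all-one matrix.  Its rank is at most the rank of \<open>R\<close>, and
  it is bounded from below in terms of the traces of \<open>P R P\<close> and of its square, which depend only on
  \<open>p\<close>, \<open>q\<close> and \<open>r\<close>.
  The rank comparison is made quantitative by
  \<open>0 \<le> tr ((R P R - \<tau> R)\<^sup>2)\<close>, which for \<open>\<tau> = (p + q) / (q + 1)\<close> evaluates to a positive multiple of
  \<open>p + q^3 - r (p + q)\<close> (\<open>compression_defect\<close>).  If the bound is attained then \<open>R P R = \<tau> R\<close>,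
  so each \<open>A(M\<^sub>i) + q I\<close> satisfies a quadratic equation modulo the all-one matrix, which is strong
  regularity of \<open>M\<^sub>i\<close>; the coefficients give the parameters.

  Everything about \<open>\<Delta>\<close> comes from tightness in the following way.  Write \<open>E\<close> and \<open>E'\<close> for the matrices of
  the cosine sequences \<open>u\<close> and \<open>w\<close> of \<open>\<theta>\<^sub>1\<close> and \<open>\<theta>\<^sub>4\<close>.  Both are positive multiples of idempotents, hence
  Gram matrices.  Their restrictions to \<open>\<Delta>\<close>, projected orthogonally to the all-one vector, are Gram
  matrices whose product has trace proportional to the defect in the fundamental bound.  Tightness
  makes that trace zero, and the trace is the squared norm of the matrix of sums in
  \<open>local_orthogonality\<close>, so all these sums vanish.  Applied to two vertices of \<open>\<Delta>\<close> this says that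
  \<open>\<Delta>\<close> is strongly regular; applied to a vertex of \<open>\<Delta>\<close> and one of the \<open>y\<^sub>i\<close>, in both
  orders, it says that the partition above is equitable.

  The intersection array is expressed by \<open>p\<close>, \<open>q\<close> and \<open>r\<close> as follows.  Antipodality leaves only
  \<open>k\<close>, \<open>b\<^sub>1\<close>, \<open>c\<^sub>2\<close> and \<open>r\<close> free.  Each eigenvalue is a root of the quadratic \<open>t\<^sup>2 - a\<^sub>1 t - k\<close> or of a cubic
  belonging to the antipodal quotient, and interlacing of the two places \<open>\<theta>\<^sub>1\<close>
  among the roots of the former and \<open>\<theta>\<^sub>4\<close> among those of the latter.  Together with the equation of tightness this
  determines \<open>\<theta>\<^sub>1\<close>, \<open>\<theta>\<^sub>4\<close> and the array in terms of \<open>q = \<theta>\<^sub>1 - a\<^sub>1\<close> and \<open>p = a\<^sub>1 / (q + 1)\<close>, and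
  the quadratic equation of \<open>\<Delta>\<close> shows that these \<open>p\<close> and \<open>-q\<close> are the nontrivial local
  eigenvalues.
\<close>

section \<open>The distance function of a connected graph\<close>

locale connected_pair_graph = pair_graph G for G :: "'a pair_pre_digraph" +
  assumes conn: "Digraph_Component.connected (with_proj G)"
begin

lemma walk_exists:
  assumes "x \<in> pverts G" "y \<in> pverts G"
  obtains w where "awalk x w y"
proof -
  obtain w where "pre_digraph.awalk (mk_symmetric (with_proj G)) x w y"
    using connected_awalkE conn assms by blast
  thus thesis using mk_symmetric_awalk_imp_awalk[OF pair_sym_arcs] that by blast
qed

lemma shortest_walk:
  assumes "x \<in> pverts G" "y \<in> pverts G"
  obtains w where "awalk x w y" "length w = gdist G x y"
proof -
  obtain w where w: "awalk x w y" using walk_exists assms by blast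
  have "\<exists>w. awalk x w y \<and> length w = gdist G x y"
    unfolding gdist_def by (rule LeastI[of _ "length w"]) (use w in blast)
  thus thesis using that by blast
qed

lemma gdist_le: "awalk x w y \<Longrightarrow> gdist G x y \<le> length w"
  unfolding gdist_def by (rule Least_le) blast

lemma gdist_eq_0:
  assumes "x \<in> pverts G" "y \<in> pverts G"
  shows "gdist G x y = 0 \<longleftrightarrow> x = y"
proof
  assume "gdist G x y = 0"
  with shortest_walk[OF assms] show "x = y" by (metis awalk_empty_ends length_0_conv)
next
  assume "x = y"
  hence "awalk x [] y" using assms by (simp add: awalk_Nil_iff)
  thus "gdist G x y = 0" using gdist_le by fastforce
qed

lemma awalk_reverse:
  "awalk x w y \<Longrightarrow> \<exists>w'. awalk y w' x \<and> length w' = length w"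
proof (induction w arbitrary: x)
  case Nil
  thus ?case by (auto simp: awalk_Nil_iff)
next
  case (Cons e w)
  obtain a b where e: "e = (a, b)" by force
  have ab: "(a, b) \<in> parcs G" "x = a" "awalk b w y"
    using Cons.prems by (auto simp: awalk_Cons_iff e)
  obtain w' where w': "awalk y w' b" "length w' = length w" using Cons.IH ab(3) by blast
  have ba: "(b, a) \<in> parcs G" using ab(1) pair_sym_arcs by (auto simp: symmetric_def sym_def)
  have "awalk b [(b, a)] a" using arc_implies_awalk[OF ba] by simp
  hence "awalk y (w' @ [(b, a)]) a" using w' awalk_appendI by blast
  thus ?case using w' ab by (intro exI[of _ "w' @ [(b,a)]"]) auto
qed

lemma gdist_sym:
  assumes "x \<in> pverts G" "y \<in> pverts G"
  shows "gdist G x y = gdist G y x"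
proof -
  have "gdist G u v \<le> gdist G v u" if "u \<in> pverts G" "v \<in> pverts G" for u v
    by (metis shortest_walk[OF that(2,1)] awalk_reverse gdist_le)
  thus ?thesis using assms by (meson dual_order.antisym)
qed

lemma gdist_triangle:
  assumes "x \<in> pverts G" "y \<in> pverts G" "z \<in> pverts G"
  shows "gdist G x z \<le> gdist G x y + gdist G y z"
proof -
  obtain v w where "awalk x v y" "length v = gdist G x y" "awalk y w z" "length w = gdist G y z"
    by (metis shortest_walk[OF assms(1,2)] shortest_walk[OF assms(2,3)])
  thus ?thesis using gdist_le[OF awalk_appendI[of x v y w z]] by simp
qed

lemma gdist_eq_1:
  assumes "x \<in> pverts G" "y \<in> pverts G"
  shows "gdist G x y = 1 \<longleftrightarrow> (x, y) \<in> parcs G"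
proof
  assume *: "gdist G x y = 1"
  obtain w where "awalk x w y" "length w = 1" using shortest_walk[OF assms] * by metis
  thus "(x, y) \<in> parcs G"
    by (cases w) (auto simp: awalk_Cons_iff awalk_Nil_iff)
next
  assume *: "(x, y) \<in> parcs G"
  hence "gdist G x y \<le> 1" using gdist_le[OF arc_implies_awalk[OF *]] by simp
  moreover have "x \<noteq> y" using * pair_no_loops by fastforce
  ultimately show "gdist G x y = 1" using gdist_eq_0 assms by (metis le_neq_implies_less less_one)
qed

lemma gdist_pred:
  assumes "x \<in> pverts G" "y \<in> pverts G" "gdist G x y = Suc n"
  shows "\<exists>z\<in>pverts G. gdist G x z = 1 \<and> gdist G z y = n"
proof -
  obtain w where w: "awalk x w y" "length w = Suc n" using shortest_walk assms by metis
  then obtain e w' where e: "w = e # w'" "length w' = n" by (auto simp: length_Suc_conv)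
  have z: "awalk (snd e) w' y" "e \<in> parcs G" "x = fst e" using w e by (auto simp: awalk_Cons_iff)
  have zV: "snd e \<in> pverts G" using z(2) arc_snd_in_verts by blast
  have 1: "gdist G x (snd e) = 1" using gdist_eq_1[OF assms(1) zV] z by simp
  have "gdist G (snd e) y \<le> n" using gdist_le[OF z(1)] e by simp
  moreover have "Suc n \<le> 1 + gdist G (snd e) y"
    using gdist_triangle[OF assms(1) zV assms(2)] 1 assms(3) by simp
  ultimately show ?thesis using 1 zV by force
qed

lemma finite_distances: "finite {gdist G x y | x y. x \<in> pverts G \<and> y \<in> pverts G}"
  by (rule finite_subset[of _ "(\<lambda>(x, y). gdist G x y) ` (pverts G \<times> pverts G)"])
    (auto simp: pair_finite_verts)

lemma pverts_nonempty: "pverts G \<noteq> {}"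
  using conn by (auto simp: Digraph_Component.connected_def strongly_connected_def)

lemma gdist_le_diameter:
  "x \<in> pverts G \<Longrightarrow> y \<in> pverts G \<Longrightarrow> gdist G x y \<le> diameter G"
  unfolding diameter_def by (rule Max_ge[OF finite_distances]) blast

lemma diameter_attained:
  obtains x y where "x \<in> pverts G" "y \<in> pverts G" "gdist G x y = diameter G"
proof -
  have "diameter G \<in> {gdist G x y | x y. x \<in> pverts G \<and> y \<in> pverts G}"
    unfolding diameter_def using pverts_nonempty by (intro Max_in[OF finite_distances]) blast
  thus thesis using that by auto
qed

end

section \<open>Distance-regular graphs as metric spaces\<close>

locale distance_regular_metric =
  fixes V :: "'a set" and d :: "'a \<Rightarrow> 'a \<Rightarrow> nat" and a b c :: "nat \<Rightarrow> nat"
  assumes finite_V: "finite V"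
    and d_eq_0: "x \<in> V \<Longrightarrow> y \<in> V \<Longrightarrow> d x y = 0 \<longleftrightarrow> x = y"
    and d_sym: "x \<in> V \<Longrightarrow> y \<in> V \<Longrightarrow> d x y = d y x"
    and d_triangle: "x \<in> V \<Longrightarrow> y \<in> V \<Longrightarrow> z \<in> V \<Longrightarrow> d x z \<le> d x y + d y z"
    and d_pred: "x \<in> V \<Longrightarrow> y \<in> V \<Longrightarrow> d x y = Suc n \<Longrightarrow> \<exists>z\<in>V. d x z = 1 \<and> d z y = n"
    and card_a: "x \<in> V \<Longrightarrow> y \<in> V \<Longrightarrow> card {z \<in> V. d x z = d x y \<and> d y z = 1} = a (d x y)"
    and card_b: "x \<in> V \<Longrightarrow> y \<in> V \<Longrightarrow> card {z \<in> V. d x z = d x y + 1 \<and> d y z = 1} = b (d x y)"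
    and card_c: "x \<in> V \<Longrightarrow> y \<in> V \<Longrightarrow> card {z \<in> V. d x z + 1 = d x y \<and> d y z = 1} = c (d x y)"
begin

definition N :: "'a \<Rightarrow> 'a set" where "N x = {z \<in> V. d x z = 1}"

lemma N_iff: "z \<in> N x \<longleftrightarrow> z \<in> V \<and> d x z = 1"
  by (simp add: N_def)

lemma finite_N [simp]: "finite (N x)"
  using finite_V by (simp add: N_def)

lemma card_N:
  assumes "x \<in> V" shows "card (N x) = b 0"
proof -
  have "d x x = 0" using d_eq_0 assms by simp
  thus ?thesis using card_b[OF assms assms] by (auto simp: N_def)
qed

text \<open>Summing a function of the distance to \<open>x\<close> over the neighbours of \<open>y\<close> is the
  three-term operation that the intersection numbers define.\<close>

definition radial :: "(nat \<Rightarrow> real) \<Rightarrow> nat \<Rightarrow> real" where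
  "radial u i = real (c i) * u (i - 1) + real (a i) * u i + real (b i) * u (i + 1)"

lemma sum_N_radial:
  assumes x: "x \<in> V" and y: "y \<in> V"
  shows "(\<Sum>z\<in>N y. u (d x z)) = radial u (d x y)"
proof -
  let ?i = "d x y"
  let ?A = "{z \<in> V. d x z = ?i \<and> d y z = 1}"
  let ?B = "{z \<in> V. d x z = ?i + 1 \<and> d y z = 1}"
  let ?C = "{z \<in> V. d x z + 1 = ?i \<and> d y z = 1}"
  have "d x z \<le> ?i + 1 \<and> ?i \<le> d x z + 1" if "z \<in> N y" for z
    using d_triangle[OF x y, of z] d_triangle[OF x _ y, of z] d_sym[of z y] that y
    by (auto simp: N_iff)
  hence N: "N y = ?C \<union> (?A \<union> ?B)"
    unfolding N_def by (auto simp: set_eq_iff) (metis le_antisym not_less_eq_eq Suc_eq_plus1)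
  have fin: "finite ?A" "finite ?B" "finite ?C" using finite_V by auto
  have "(\<Sum>z\<in>N y. u (d x z)) = (\<Sum>z\<in>?C. u (d x z)) + ((\<Sum>z\<in>?A. u (d x z)) + (\<Sum>z\<in>?B. u (d x z)))"
    unfolding N using fin by (subst sum.union_disjoint, auto)+
  also have "(\<Sum>z\<in>?C. u (d x z)) = (\<Sum>z\<in>?C. u (?i - 1))"
    by (intro sum.cong arg_cong[of _ _ u]) auto
  also have "(\<Sum>z\<in>?A. u (d x z)) = (\<Sum>z\<in>?A. u ?i)" by (intro sum.cong) auto
  also have "(\<Sum>z\<in>?B. u (d x z)) = (\<Sum>z\<in>?B. u (?i + 1))" by (intro sum.cong) auto
  finally show ?thesis
    unfolding radial_def using card_a[OF x y] card_b[OF x y] card_c[OF x y] by simp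
qed

lemma abc_sum:
  assumes "x \<in> V" "y \<in> V"
  shows "c (d x y) + a (d x y) + b (d x y) = b 0"
  using sum_N_radial[OF assms, of "\<lambda>_. 1"] card_N[OF assms(2)]
  by (simp add: radial_def flip: of_nat_add)

lemma sum_N_swap:
  "(\<Sum>y\<in>V. \<Sum>z\<in>N y. g y z) = (\<Sum>z\<in>V. \<Sum>y\<in>N z. g y z)"
proof -
  have "(\<Sum>y\<in>V. \<Sum>z\<in>N y. g y z) = (\<Sum>y\<in>V. \<Sum>z\<in>V. if d y z = 1 then g y z else 0)"
    unfolding N_def using finite_V by (intro sum.cong refl sum.inter_filter)
  also have "\<dots> = (\<Sum>z\<in>V. \<Sum>y\<in>V. if d y z = 1 then g y z else 0)" by (rule sum.swap)
  also have "\<dots> = (\<Sum>z\<in>V. \<Sum>y\<in>V. if d z y = 1 then g y z else 0)"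
    by (intro sum.cong refl) (simp add: d_sym)
  also have "\<dots> = (\<Sum>z\<in>V. \<Sum>y\<in>N z. g y z)"
    unfolding N_def using finite_V by (intro sum.cong refl sum.inter_filter[symmetric])
  finally show ?thesis .
qed

definition eigenfunction :: "real \<Rightarrow> ('a \<Rightarrow> real) \<Rightarrow> bool" where
  "eigenfunction \<theta> f \<longleftrightarrow> (\<forall>y\<in>V. (\<Sum>z\<in>N y. f z) = \<theta> * f y)"

text \<open>Sums of an eigenfunction over the spheres around a vertex obey the three-term recurrence
  dual to the one of the cosine sequence.\<close>

definition sphere_sum :: "('a \<Rightarrow> real) \<Rightarrow> nat \<Rightarrow> 'a \<Rightarrow> real" where
  "sphere_sum f i y = (\<Sum>z | z \<in> V \<and> d y z = i. f z)"

lemma sphere_sum_alt: "sphere_sum f i y = (\<Sum>z\<in>V. (if d y z = i then 1 else 0) * f z)"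
proof -
  have "sphere_sum f i y = (\<Sum>z\<in>V. if d y z = i then f z else 0)"
    unfolding sphere_sum_def using finite_V by (rule sum.inter_filter)
  also have "\<dots> = (\<Sum>z\<in>V. (if d y z = i then 1 else 0) * f z)"
    by (intro sum.cong) auto
  finally show ?thesis .
qed

lemma sphere_sum_0: "y \<in> V \<Longrightarrow> sphere_sum f 0 y = f y"
proof -
  assume y: "y \<in> V"
  have "{z. z \<in> V \<and> d y z = 0} = {y}" using y d_eq_0 by auto
  thus ?thesis by (simp add: sphere_sum_def)
qed

text \<open>The adjacency matrix is symmetric, so it may be moved from the eigenfunction to the radial
  weight.\<close>

lemma eigenfunction_radial:
  assumes f: "eigenfunction \<theta> f" and y: "y \<in> V"
  shows "\<theta> * (\<Sum>z\<in>V. u (d y z) * f z) = (\<Sum>z\<in>V. radial u (d y z) * f z)"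
proof -
  have "\<theta> * (\<Sum>z\<in>V. u (d y z) * f z) = (\<Sum>z\<in>V. u (d y z) * (\<Sum>w\<in>N z. f w))"
    using f by (simp add: eigenfunction_def sum_distrib_left mult_ac)
  also have "\<dots> = (\<Sum>z\<in>V. \<Sum>w\<in>N z. u (d y z) * f w)" by (simp add: sum_distrib_left)
  also have "\<dots> = (\<Sum>w\<in>V. \<Sum>z\<in>N w. u (d y z) * f w)" by (rule sum_N_swap)
  also have "\<dots> = (\<Sum>w\<in>V. (\<Sum>z\<in>N w. u (d y z)) * f w)" by (simp add: sum_distrib_right)
  also have "\<dots> = (\<Sum>w\<in>V. radial u (d y w) * f w)" using y by (simp add: sum_N_radial)
  finally show ?thesis .
qed

lemma c_0: "V \<noteq> {} \<Longrightarrow> c 0 = 0"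
proof -
  assume "V \<noteq> {}"
  then obtain x where x: "x \<in> V" by blast
  have "d x x = 0" using d_eq_0 x by simp
  thus ?thesis using card_c[OF x x] by auto
qed

lemma sphere_sum_rec_0:
  assumes f: "eigenfunction \<theta> f" and y: "y \<in> V"
  shows "\<theta> * sphere_sum f 0 y = real (a 0) * sphere_sum f 0 y + real (c 1) * sphere_sum f 1 y"
proof -
  have c0: "c 0 = 0" using c_0 y by blast
  have "\<theta> * sphere_sum f 0 y = (\<Sum>z\<in>V. radial (\<lambda>j. if j = 0 then 1 else 0) (d y z) * f z)"
    unfolding sphere_sum_alt by (rule eigenfunction_radial[OF f y])
  also have "\<dots> = (\<Sum>z\<in>V. real (a 0) * ((if d y z = 0 then 1 else 0) * f z) +
       real (c 1) * ((if d y z = 1 then 1 else 0) * f z))"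
    by (intro sum.cong) (auto simp: radial_def algebra_simps c0)
  also have "\<dots> = real (a 0) * sphere_sum f 0 y + real (c 1) * sphere_sum f 1 y"
    unfolding sphere_sum_alt sum.distrib sum_distrib_left by (simp add: algebra_simps)
  finally show ?thesis .
qed

lemma sphere_sum_rec:
  assumes f: "eigenfunction \<theta> f" and y: "y \<in> V"
  shows "\<theta> * sphere_sum f (Suc i) y = real (b i) * sphere_sum f i y +
     real (a (Suc i)) * sphere_sum f (Suc i) y + real (c (Suc (Suc i))) * sphere_sum f (Suc (Suc i)) y"
proof -
  have c0: "c 0 = 0" using c_0 y by blast
  have "\<theta> * sphere_sum f (Suc i) y = (\<Sum>z\<in>V. radial (\<lambda>j. if j = Suc i then 1 else 0) (d y z) * f z)"
    unfolding sphere_sum_alt by (rule eigenfunction_radial[OF f y])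
  also have "\<dots> = (\<Sum>z\<in>V. real (b i) * ((if d y z = i then 1 else 0) * f z) +
       (real (a (Suc i)) * ((if d y z = Suc i then 1 else 0) * f z) +
       real (c (Suc (Suc i))) * ((if d y z = Suc (Suc i) then 1 else 0) * f z)))"
    by (intro sum.cong) (auto simp: radial_def algebra_simps c0)
  also have "\<dots> = real (b i) * sphere_sum f i y +
     (real (a (Suc i)) * sphere_sum f (Suc i) y + real (c (Suc (Suc i))) * sphere_sum f (Suc (Suc i)) y)"
    unfolding sphere_sum_alt sum.distrib sum_distrib_left by (simp add: algebra_simps)
  finally show ?thesis by simp
qed

text \<open>The recurrence determines the sphere sums from \<open>sphere_sum f 0 y = f y\<close>, since \<open>c (Suc i)\<close> can be
  divided out below the diameter.\<close>

lemma sphere_sum_multiple: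
  assumes "\<And>i. i < m \<Longrightarrow> c (Suc i) \<noteq> 0"
  shows "i \<le> m \<Longrightarrow> \<exists>v. \<forall>f y. eigenfunction \<theta> f \<longrightarrow> y \<in> V \<longrightarrow> sphere_sum f i y = v * f y"
proof (induction i rule: less_induct)
  case (less i)
  show ?case
  proof (cases i)
    case 0
    show ?thesis unfolding 0 by (intro exI[of _ 1]) (simp add: sphere_sum_0)
  next
    case [simp]: (Suc j)
    have cpos: "c (Suc j) \<noteq> 0" using assms less.prems by simp
    obtain v where v: "\<And>f y. eigenfunction \<theta> f \<Longrightarrow> y \<in> V \<Longrightarrow> sphere_sum f j y = v * f y"
      using less.IH[of j] less.prems by auto
    show ?thesis
    proof (cases j)
      case [simp]: 0
      have "sphere_sum f i y = (\<theta> - a 0) / c 1 * f y"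
        if "eigenfunction \<theta> f" "y \<in> V" for f y
        using sphere_sum_rec_0[OF that] cpos that(2) by (simp add: sphere_sum_0 field_simps)
      thus ?thesis by blast
    next
      case [simp]: (Suc l)
      obtain w where w: "\<And>f y. eigenfunction \<theta> f \<Longrightarrow> y \<in> V \<Longrightarrow> sphere_sum f l y = w * f y"
        using less.IH[of l] less.prems by auto
      have "sphere_sum f i y = ((\<theta> - a j) * v - b l * w) / c i * f y"
        if "eigenfunction \<theta> f" "y \<in> V" for f y
        using sphere_sum_rec[OF that, of l] cpos v[OF that] w[OF that] by (simp add: field_simps)
      thus ?thesis by blast
    qed
  qed
qed

text \<open>A linear combination of distance matrices acts as a scalar on each eigenspace, because it is a
  polynomial in the adjacency matrix.  The scalar depends on the combination and the eigenvalue only.\<close>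

lemma radial_operator_scalar:
  assumes c: "\<And>i. i < m \<Longrightarrow> c (Suc i) \<noteq> 0" and diam: "\<And>x y. x \<in> V \<Longrightarrow> y \<in> V \<Longrightarrow> d x y \<le> m"
  obtains C where "\<And>f y. eigenfunction \<theta> f \<Longrightarrow> y \<in> V \<Longrightarrow> (\<Sum>z\<in>V. g (d y z) * f z) = C * f y"
proof -
  have "\<forall>i\<in>{..m}. \<exists>v. \<forall>f y. eigenfunction \<theta> f \<longrightarrow> y \<in> V \<longrightarrow> sphere_sum f i y = v * f y"
    using sphere_sum_multiple[OF c] by blast
  then obtain v where
    v: "\<And>f y i. i \<in> {..m} \<Longrightarrow> eigenfunction \<theta> f \<Longrightarrow> y \<in> V \<Longrightarrow> sphere_sum f i y = v i * f y"
    by (metis (no_types, lifting))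
  have "(\<Sum>z\<in>V. g (d y z) * f z) = (\<Sum>i\<le>m. g i * v i) * f y"
    if f: "eigenfunction \<theta> f" and y: "y \<in> V" for f y
  proof -
    have "(\<Sum>z\<in>V. g (d y z) * f z) = (\<Sum>i\<le>m. \<Sum>z | z \<in> V \<and> d y z = i. g (d y z) * f z)"
      by (rule sum.group[symmetric]) (use finite_V diam y in auto)
    also have "\<dots> = (\<Sum>i\<le>m. g i * sphere_sum f i y)"
      unfolding sphere_sum_def sum_distrib_left by (intro sum.cong) auto
    also have "\<dots> = (\<Sum>i\<le>m. g i * v i) * f y"
      using v[OF _ f y] by (simp add: sum_distrib_right mult.assoc)
    finally show ?thesis .
  qed
  thus thesis using that by blast
qed

text \<open>The columns of the matrix of a cosine sequence are eigenfunctions, so the matrix, which is itself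
  a function of the distance matrices, acts on them as a scalar.  The scalar is positive because
  the diagonal entries of the square are sums of squares with one term equal to \<open>1\<close>.\<close>

lemma cosine_matrix_square:
  assumes c: "\<And>i. i < m \<Longrightarrow> c (Suc i) \<noteq> 0" and diam: "\<And>x y. x \<in> V \<Longrightarrow> y \<in> V \<Longrightarrow> d x y \<le> m"
    and u: "\<And>i. i \<le> m \<Longrightarrow> radial u i = \<theta> * u i" and u0: "u 0 = 1" and V: "V \<noteq> {}"
  obtains C where "C > 0"
    "\<And>y z. y \<in> V \<Longrightarrow> z \<in> V \<Longrightarrow> (\<Sum>w\<in>V. u (d y w) * u (d w z)) = C * u (d y z)"
proof -
  obtain C where C: "\<And>f y. eigenfunction \<theta> f \<Longrightarrow> y \<in> V \<Longrightarrow> (\<Sum>z\<in>V. u (d y z) * f z) = C * f y"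
    using radial_operator_scalar[OF c diam, where g = u and \<theta> = \<theta>] by blast
  have eig: "eigenfunction \<theta> (\<lambda>w. u (d w z))" if z: "z \<in> V" for z
    unfolding eigenfunction_def
  proof
    fix y assume y: "y \<in> V"
    have "(\<Sum>w\<in>N y. u (d w z)) = (\<Sum>w\<in>N y. u (d z w))"
      using z by (intro sum.cong) (auto simp: N_iff d_sym)
    also have "\<dots> = \<theta> * u (d z y)" using sum_N_radial[OF z y] u diam z y by simp
    finally show "(\<Sum>w\<in>N y. u (d w z)) = \<theta> * u (d y z)" using d_sym y z by simp
  qed
  have sq: "(\<Sum>w\<in>V. u (d y w) * u (d w z)) = C * u (d y z)" if "y \<in> V" "z \<in> V" for y z
    using C[OF eig] that by blast
  obtain x where x: "x \<in> V" using V by blast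
  have "1 \<le> (\<Sum>w\<in>V. u (d x w) * u (d w x))"
  proof -
    have "(\<Sum>w\<in>{x}. u (d x w) * u (d w x)) \<le> (\<Sum>w\<in>V. u (d x w) * u (d w x))"
      by (rule sum_mono2) (use x finite_V d_sym in auto)
    thus ?thesis using d_eq_0[OF x x] u0 by simp
  qed
  hence "C > 0" using sq[OF x x] d_eq_0[OF x x] u0 by simp
  thus thesis using that sq by blast
qed

end

section \<open>Antipodal covers of diameter four\<close>

locale antipodal_diameter_4 = distance_regular_metric +
  fixes r :: nat
  assumes diam: "x \<in> V \<Longrightarrow> y \<in> V \<Longrightarrow> d x y \<le> 4"
    and far: "\<exists>x\<in>V. \<exists>y\<in>V. d x y = 4"
    and antipodal: "x \<in> V \<Longrightarrow> y \<in> V \<Longrightarrow> z \<in> V \<Longrightarrow> d x y = 4 \<Longrightarrow> d x z = 4 \<Longrightarrow> y = z \<or> d y z = 4"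
    and card_fibre: "x \<in> V \<Longrightarrow> card {z \<in> V. d x z = 0 \<or> d x z = 4} = r"
begin

definition F :: "'a \<Rightarrow> 'a set" where "F x = {z \<in> V. d x z = 0 \<or> d x z = 4}"

lemma F_self: "x \<in> V \<Longrightarrow> x \<in> F x"
  by (simp add: F_def d_eq_0)

lemma F_iff: "x \<in> V \<Longrightarrow> z \<in> F x \<longleftrightarrow> z \<in> V \<and> (z = x \<or> d x z = 4)"
  by (auto simp: F_def d_eq_0)

lemma F_V: "z \<in> F x \<Longrightarrow> z \<in> V"
  by (simp add: F_def)

lemma finite_F [simp]: "finite (F x)"
  using finite_V by (simp add: F_def)

lemma card_F: "x \<in> V \<Longrightarrow> card (F x) = r"
  using card_fibre by (simp add: F_def)

lemma F_dist:
  assumes "x \<in> V" "y \<in> F x" "z \<in> F x" "y \<noteq> z" shows "d y z = 4"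
  using assms antipodal[of x y z] d_sym by (auto simp: F_iff)

lemma geodesic: "i \<le> 4 \<Longrightarrow> \<exists>x\<in>V. \<exists>y\<in>V. d x y = i"
proof (induction "4 - i" arbitrary: i)
  case 0
  thus ?case using far by auto
next
  case (Suc n)
  then obtain x y where "x \<in> V" "y \<in> V" "d x y = Suc i"
    using Suc.hyps(1)[of "Suc i"] Suc.hyps(2) by fastforce
  thus ?case using d_pred by blast
qed

text \<open>An edge of this kind witnesses that \<open>b i\<close> and \<open>c (Suc i)\<close> are positive.\<close>

lemma edge_between_spheres:
  assumes "i < 4"
  obtains y z w where "y \<in> V" "z \<in> V" "w \<in> V" "d y z = Suc i" "d y w = i" "d z w = 1"
proof -
  obtain z y where zy: "z \<in> V" "y \<in> V" "d z y = Suc i" using geodesic[of "Suc i"] assms by auto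
  then obtain w where "w \<in> V" "d z w = 1" "d w y = i" using d_pred by blast
  thus thesis using that[of y z w] zy d_sym by metis
qed

lemma c_pos: "i < 4 \<Longrightarrow> c (Suc i) > 0"
proof -
  assume "i < 4"
  then obtain y z w where *: "y \<in> V" "z \<in> V" "w \<in> V" "d y z = Suc i" "d y w = i" "d z w = 1"
    using edge_between_spheres by blast
  have "{v \<in> V. d y v + 1 = d y z \<and> d z v = 1} \<noteq> {}" using * by auto
  hence "card {v \<in> V. d y v + 1 = d y z \<and> d z v = 1} > 0" using finite_V by (simp add: card_gt_0_iff)
  thus ?thesis using card_c[of y z] * by simp
qed

lemma b_pos: "i < 4 \<Longrightarrow> b i > 0"
proof -
  assume "i < 4"
  then obtain y z w where *: "y \<in> V" "z \<in> V" "w \<in> V" "d y z = Suc i" "d y w = i" "d z w = 1"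
    using edge_between_spheres by blast
  have "z \<in> {v \<in> V. d y v = d y w + 1 \<and> d w v = 1}" using * d_sym by auto
  hence "card {v \<in> V. d y v = d y w + 1 \<and> d w v = 1} > 0" using finite_V card_gt_0_iff by fastforce
  thus ?thesis using card_b[of y w] * by simp
qed

lemma extend:
  assumes "x \<in> V" "y \<in> V" "d x y < 4"
  obtains z where "z \<in> V" "d x z = d x y + 1" "d y z = 1"
proof -
  have "card {z \<in> V. d x z = d x y + 1 \<and> d y z = 1} > 0"
    using card_b[OF assms(1,2)] b_pos[OF assms(3)] by simp
  hence "{z \<in> V. d x z = d x y + 1 \<and> d y z = 1} \<noteq> {}" by (metis card.empty less_irrefl)
  thus thesis using that by blast
qed

text \<open>A vertex at distance \<open>4\<close> from one member of an antipodal class is at distance \<open>0\<close> or \<open>4\<close> from all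
  members.  This and the triangle inequality leave only one possible distance here, and only
  \<open>2\<close> and \<open>3\<close> in the next lemma.\<close>

lemma fibre_dist_1:
  assumes "x \<in> V" "x' \<in> F x" "x' \<noteq> x" "y \<in> V" "d x y = 1"
  shows "d x' y = 3"
proof -
  have x': "x' \<in> V" "d x' x = 4" using assms d_sym by (auto simp: F_iff)
  have "4 \<le> d x' y + 1" using d_triangle[OF x'(1) assms(4,1)] x'(2) assms d_sym by simp
  moreover have "d x' y \<noteq> 4" using antipodal[OF x'(1) assms(1,4)] x' assms d_eq_0[OF assms(1,4)] by auto
  ultimately show ?thesis using diam[OF x'(1) assms(4)] by linarith
qed

lemma fibre_dist_2:
  assumes "x \<in> V" "x' \<in> F x" "y \<in> V" "d x y = 2"
  shows "d x' y = 2"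
proof (cases "x' = x")
  case False
  have x': "x' \<in> V" "d x' x = 4" using assms d_sym False by (auto simp: F_iff)
  have "4 \<le> d x' y + 2" using d_triangle[OF x'(1) assms(3,1)] x'(2) assms d_sym by simp
  moreover have "d x' y \<noteq> 4" using antipodal[OF x'(1) assms(1,3)] x' assms d_eq_0[OF assms(1,3)] by auto
  moreover have "d x' y \<noteq> 3"
  proof
    assume 3: "d x' y = 3"
    \<comment> \<open>A geodesic from \<open>x'\<close> to \<open>y\<close> extends to a member \<open>z\<close> of the class of \<open>x\<close> adjacent to \<open>y\<close>.
        As \<open>y\<close> is at distance \<open>2\<close> from \<open>x\<close>, this \<open>z\<close> is neither \<open>x\<close> nor at distance \<open>4\<close> from \<open>x\<close>.\<close>
    then obtain z where z: "z \<in> V" "d x' z = 4" "d y z = 1" using extend[OF x'(1) assms(3)] by auto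
    have "x = z \<or> d x z = 4" using antipodal[OF x'(1) assms(1) z(1)] x' z by simp
    moreover have "d x z \<le> 3" using d_triangle[OF assms(1,3) z(1)] assms(4) z(3) by simp
    moreover have "x \<noteq> z" using z assms d_sym by fastforce
    ultimately show False by simp
  qed
  ultimately show ?thesis using diam[OF x'(1) assms(3)] by linarith
qed (use assms in simp)

lemma fibre_neighbour_unique:
  assumes "x \<in> V" "x' \<in> F x" "x'' \<in> F x" "y \<in> V" "d x' y = 1" "d x'' y = 1"
  shows "x' = x''"
proof (rule ccontr)
  assume "x' \<noteq> x''"
  hence "d x' x'' = 4" using F_dist assms by blast
  moreover have "d x' x'' \<le> 2"
    using d_triangle[of x' y x''] d_sym[of y x''] assms F_V by fastforce
  ultimately show False by simp
qed

lemma fibre_neighbour_exists: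
  assumes "x \<in> V" "y \<in> V" "d x y = 3"
  obtains x' where "x' \<in> F x" "x' \<noteq> x" "d x' y = 1"
proof -
  obtain z where z: "z \<in> V" "d x z = 4" "d y z = 1" using extend[OF assms(1,2)] assms by auto
  show thesis
  proof (rule that)
    show "z \<in> F x" using z assms by (simp add: F_iff)
    show "z \<noteq> x" using z(2) d_eq_0[OF assms(1,1)] by auto
    show "d z y = 1" using z d_sym[OF z(1) assms(2)] by simp
  qed
qed

lemma F_sym: "x \<in> V \<Longrightarrow> x' \<in> F x \<Longrightarrow> x \<in> F x'"
  by (auto simp: F_def d_sym)

lemma a_0: "a 0 = 0"
proof -
  obtain x where x: "x \<in> V" using far by blast
  hence "d x x = 0" by (simp add: d_eq_0)
  moreover have "{z \<in> V. d x z = 0 \<and> d x z = 1} = {}" by auto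
  ultimately show ?thesis using card_a[OF x x] by (metis card.empty)
qed

lemma c_1: "c 1 = 1"
proof -
  obtain x y where xy: "x \<in> V" "y \<in> V" "d x y = 1" using geodesic[of 1] by auto
  have "{z \<in> V. d x z + 1 = d x y \<and> d y z = 1} = {x}" using xy d_eq_0 d_sym by auto
  thus ?thesis using card_c[OF xy(1,2)] xy(3) by simp
qed

text \<open>The intersection array is now read off by passing from \<open>x\<close> to another member of its antipodal
  class: distance \<open>2\<close> is preserved, and a vertex at distance \<open>3\<close> from \<open>x\<close> is adjacent to exactly one
  other member.\<close>

lemma b_3: "b 3 = 1"
proof -
  obtain x y where xy: "x \<in> V" "y \<in> V" "d x y = 3" using geodesic[of 3] by auto
  obtain x' where x': "x' \<in> F x" "x' \<noteq> x" "d x' y = 1" using fibre_neighbour_exists[OF xy] .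
  have unique: "z = x'" if "z \<in> V" "d x z = 4" "d y z = 1" for z
  proof -
    have "z \<in> F x" using that xy by (simp add: F_iff)
    moreover have "d z y = 1" using d_sym[OF that(1) xy(2)] that(3) by simp
    ultimately show ?thesis using fibre_neighbour_unique[OF xy(1) _ x'(1) xy(2) _ x'(3)] by blast
  qed
  have "x' \<in> V" "d x x' = 4" "d y x' = 1"
    using x' xy F_V[OF x'(1)] d_sym[of x' y] by (auto simp: F_iff)
  hence "{z \<in> V. d x z = 4 \<and> d y z = 1} = {x'}"
    using unique by blast
  thus ?thesis using card_b[OF xy(1,2)] xy(3) by simp
qed

lemma c_3: "c 3 = b 1"
proof -
  obtain x y where xy: "x \<in> V" "y \<in> V" "d x y = 3" using geodesic[of 3] by auto
  obtain x' where x': "x' \<in> F x" "x' \<noteq> x" "d x' y = 1" using fibre_neighbour_exists[OF xy] .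
  have x'V: "x' \<in> V" using x' F_V by blast
  have "d x z = 2 \<longleftrightarrow> d x' z = 2" if "z \<in> V" for z
    using fibre_dist_2[OF xy(1) x'(1) that] fibre_dist_2[OF x'V F_sym[OF xy(1) x'(1)] that] by blast
  hence "{z \<in> V. d x z + 1 = d x y \<and> d y z = 1} = {z \<in> V. d x' z = d x' y + 1 \<and> d y z = 1}"
    using xy(3) x'(3) by auto
  thus ?thesis using card_c[OF xy(1,2)] card_b[OF x'V xy(2)] xy(3) x'(3) by simp
qed

lemma c_4: "c 4 = b 0"
proof -
  obtain x y where xy: "x \<in> V" "y \<in> V" "d x y = 4" using geodesic[of 4] by auto
  have "d x z = 3" if "z \<in> V" "d y z = 1" for z
  proof (rule fibre_dist_1[OF xy(2) _ _ that])
    show "x \<in> F y" using xy d_sym[OF xy(1,2)] by (simp add: F_iff)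
    show "x \<noteq> y" using xy d_eq_0[OF xy(1,2)] by auto
  qed
  hence "{z \<in> V. d x z + 1 = d x y \<and> d y z = 1} = N y" using xy(3) by (auto simp: N_iff)
  thus ?thesis using card_c[OF xy(1,2)] card_N[OF xy(2)] xy(3) by simp
qed

lemma b_4: "b 4 = 0"
proof -
  obtain x y where xy: "x \<in> V" "y \<in> V" "d x y = 4" using geodesic[of 4] by auto
  have "{z \<in> V. d x z = d x y + 1 \<and> d y z = 1} = {}" using xy diam by fastforce
  thus ?thesis using card_b[OF xy(1,2)] xy(3) by (metis card.empty)
qed

text \<open>The vertices at distance \<open>3\<close> from \<open>x\<close> are the disjoint union of the neighbourhoods of the other
  \<open>r - 1\<close> members of its class.\<close>

lemma b_2: "b 2 = (r - 1) * c 2"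
proof -
  obtain x y where xy: "x \<in> V" "y \<in> V" "d x y = 2" using geodesic[of 2] by auto
  let ?S = "\<lambda>x'. {z \<in> V. d x' z + 1 = 2 \<and> d y z = 1}"
  have "{z \<in> V. d x z = d x y + 1 \<and> d y z = 1} = (\<Union>x'\<in>F x - {x}. ?S x')" (is "?L = ?R")
  proof (intro equalityI subsetI)
    fix z assume z: "z \<in> ?L"
    hence "d x z = 3" using xy by simp
    then obtain x' where "x' \<in> F x" "x' \<noteq> x" "d x' z = 1"
      using fibre_neighbour_exists[OF xy(1)] z by blast
    thus "z \<in> ?R" using z by auto
  next
    fix z assume "z \<in> ?R"
    then obtain x' where x': "x' \<in> F x" "x' \<noteq> x" "z \<in> V" "d x' z = 1" "d y z = 1" by auto
    have "d x z = 3"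
      using fibre_dist_1[OF F_V[OF x'(1)] F_sym[OF xy(1) x'(1)] _ x'(3,4)] x' by blast
    thus "z \<in> ?L" using x' xy by simp
  qed
  hence "b 2 = card (\<Union>x'\<in>F x - {x}. ?S x')" using card_b[OF xy(1,2)] xy(3) by simp
  also have "\<dots> = (\<Sum>x'\<in>F x - {x}. card (?S x'))"
    using fibre_neighbour_unique[OF xy(1)] finite_V by (subst card_UN_disjoint) auto
  also have "\<dots> = (\<Sum>x'\<in>F x - {x}. c 2)"
  proof (rule sum.cong[OF refl])
    fix x' assume "x' \<in> F x - {x}"
    thus "card (?S x') = c 2"
      using card_c[OF F_V xy(2), of x' x] fibre_dist_2[OF xy(1) _ xy(2,3), of x'] by simp
  qed
  also have "\<dots> = (r - 1) * c 2" using card_F[OF xy(1)] F_self[OF xy(1)] by simp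
  finally show ?thesis .
qed

lemma r_ge_2: "r \<ge> 2"
proof -
  obtain x y where xy: "x \<in> V" "y \<in> V" "d x y = 4" using far by blast
  have "x \<noteq> y" using xy d_eq_0 by force
  moreover have "{x, y} \<subseteq> F x" using xy by (auto simp: F_iff)
  ultimately show ?thesis using card_mono[OF finite_F, of "{x, y}" x] card_F[OF xy(1)] by simp
qed

lemma abc_sum': "i \<le> 4 \<Longrightarrow> c i + a i + b i = b 0"
  using geodesic abc_sum by metis

lemma V_nonempty: "V \<noteq> {}"
  using far by blast

lemma a_4: "a 4 = 0"
  using abc_sum'[of 4] c_4 by simp

lemma a_3: "a 3 = a 1"
  using abc_sum'[of 3] abc_sum'[of 1] c_3 b_3 c_1 by simp

definition k :: real where "k = real (b 0)"
definition a1 :: real where "a1 = real (a 1)"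
definition b1 :: real where "b1 = real (b 1)"
definition c2 :: real where "c2 = real (c 2)"

lemma k_eq: "k = 1 + a1 + b1"
  using abc_sum'[of 1] c_1 unfolding k_def a1_def b1_def by linarith

lemma real_b_2: "real (b 2) = (real r - 1) * c2"
  using b_2 r_ge_2 by (simp add: c2_def of_nat_diff)

lemma real_a_2: "real (a 2) = k - real r * c2"
proof -
  have "real (c 2) + real (a 2) + real (b 2) = real (b 0)"
    using abc_sum'[of 2] by linarith
  thus ?thesis using real_b_2 unfolding k_def c2_def by (simp add: algebra_simps)
qed

lemma k_pos: "k > 0" and b1_pos: "b1 > 0" and c2_pos: "c2 > 0" and a1_nonneg: "a1 \<ge> 0"
  using b_pos[of 0] b_pos[of 1] c_pos[of 1]
  by (simp_all add: k_def b1_def c2_def a1_def numeral_2_eq_2)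

text \<open>On the antipodal classes an eigenfunction either has sum zero or is constant.  In the first
  case its eigenvalue is a root of the quadratic; in the second case it is an eigenvalue of the
  antipodal quotient, and a root of the cubic.  In terms of the normalised sphere sums \<open>s\<close>, the
  second case is \<open>s 4 = r - 1\<close>.\<close>

lemma eigenvalue_cases:
  assumes f: "eigenfunction \<theta> f" and x: "x \<in> V" "f x \<noteq> 0"
  shows "\<theta>\<^sup>2 - a1 * \<theta> - k = 0 \<or>
    (\<theta> - (k - real r * c2)) * (\<theta>\<^sup>2 - a1 * \<theta> - k) = real r * c2 * b1 * \<theta>"
proof -
  define s where "s i = sphere_sum f i x / f x" for i
  have s0: "s 0 = 1" using x by (simp add: s_def sphere_sum_0)
  have rec0: "\<theta> * s 0 = s 1"
    using sphere_sum_rec_0[OF f x(1)] x(2) c_1 by (simp add: s_def a_0 field_simps)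
  have rec: "\<theta> * s (Suc i) = real (b i) * s i + real (a (Suc i)) * s (Suc i) +
      real (c (Suc (Suc i))) * s (Suc (Suc i))" for i
    using sphere_sum_rec[OF f x(1), of i] x(2) by (simp add: s_def field_simps)
  have 1: "\<theta> * s 1 = k + a1 * s 1 + c2 * s 2"
    using rec[of 0] s0 by (simp add: k_def a1_def c2_def numeral_2_eq_2)
  have 2: "\<theta> * s 2 = b1 * s 1 + (k - real r * c2) * s 2 + b1 * s 3"
    using rec[of 1] c_3 real_a_2 by (simp add: b1_def numeral_2_eq_2 numeral_3_eq_3)
  have 3: "\<theta> * s 3 = (real r - 1) * c2 * s 2 + a1 * s 3 + k * s 4"
    using rec[of 2] c_4 a_3 real_b_2 by (simp add: k_def a1_def numeral_2_eq_2 numeral_3_eq_3 numeral_eq_Suc)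
  have "sphere_sum f 5 x = 0"
  proof -
    have "d x z \<noteq> 5" if "z \<in> V" for z using diam[OF x(1) that] by simp
    thus ?thesis unfolding sphere_sum_def by (intro sum.neutral) auto
  qed
  hence 4: "\<theta> * s 4 = s 3"
    using rec[of 3] a_4 b_3 by (simp add: s_def numeral_eq_Suc)
  let ?Q = "\<theta>\<^sup>2 - a1 * \<theta> - k"
  have s1: "s 1 = \<theta>" using rec0 s0 by simp
  have Q2: "c2 * s 2 = ?Q" using 1 s1 by (simp add: power2_eq_square)
  have "?Q * s 4 = \<theta> * s 3 - a1 * s 3 - k * s 4" unfolding 4[symmetric] by (simp add: power2_eq_square algebra_simps)
  also have "\<dots> = (real r - 1) * ?Q" using 3 unfolding Q2[symmetric] by (simp add: algebra_simps)
  finally have "?Q * (s 4 - (real r - 1)) = 0" by (simp only: right_diff_distrib mult.commute diff_self)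
  hence "?Q = 0 \<or> s 4 = real r - 1" by (metis mult_eq_0_iff eq_iff_diff_eq_0)
  moreover have "(\<theta> - (k - real r * c2)) * ?Q = real r * c2 * b1 * \<theta>" if "s 4 = real r - 1"
  proof -
    have s3: "s 3 = (real r - 1) * \<theta>" using 4 that by (simp add: algebra_simps)
    have "(\<theta> - (k - real r * c2)) * ?Q = c2 * (\<theta> * s 2 - (k - real r * c2) * s 2)"
      unfolding Q2[symmetric] by (simp add: algebra_simps)
    also have "\<dots> = c2 * (b1 * s 1 + b1 * s 3)" using 2 by simp
    also have "\<dots> = real r * c2 * b1 * \<theta>" unfolding s1 s3 by (simp add: algebra_simps)
    finally show ?thesis .
  qed
  ultimately show ?thesis by blast
qed

end

section \<open>Interlacing of the eigenvalues\<close>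

lemma quadratic_three_roots:
  fixes x y z :: real
  assumes "u * x\<^sup>2 + v * x + w = 0" "u * y\<^sup>2 + v * y + w = 0" "u * z\<^sup>2 + v * z + w = 0"
    and ne: "x \<noteq> y" "y \<noteq> z" "x \<noteq> z"
  shows "u = 0 \<and> v = 0 \<and> w = 0"
proof -
  have "(x - y) * (u * (x + y) + v) = 0" "(y - z) * (u * (y + z) + v) = 0"
    using assms(1-3) by (simp_all add: algebra_simps power2_eq_square)
  hence 1: "u * (x + y) + v = 0" "u * (y + z) + v = 0" using ne by auto
  hence "u * (x - z) = 0" by algebra
  thus ?thesis using 1 assms(1) ne by auto
qed

lemma cubic_factors:
  fixes x y z t :: real
  assumes g: "\<And>t. g t = t ^ 3 + u * t\<^sup>2 + v * t + w"
    and "g x = 0" "g y = 0" "g z = 0" and ne: "x \<noteq> y" "y \<noteq> z" "x \<noteq> z"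
  shows "g t = (t - x) * (t - y) * (t - z)"
proof -
  let ?h = "\<lambda>t. (u + x + y + z) * t\<^sup>2 + (v - x * y - y * z - x * z) * t + (w + x * y * z)"
  have h: "?h t = g t - (t - x) * (t - y) * (t - z)" for t
    unfolding g by (simp add: algebra_simps power2_eq_square power3_eq_cube)
  have "?h x = 0" "?h y = 0" "?h z = 0" unfolding h using assms by auto
  from quadratic_three_roots[OF this ne] have "?h t = 0" by simp
  thus ?thesis unfolding h by simp
qed

text \<open>At a root of the quadratic the cubic takes the value \<open>- D t\<close>, and the roots of the quadratic have
  opposite signs.  So the sign of the cubic at the two roots is known, which locates its own
  roots.\<close>

lemma interlacing:
  fixes A K D m :: real
  defines "Q \<equiv> \<lambda>t. t\<^sup>2 - A * t - K" and "g \<equiv> \<lambda>t. (t - m) * (t\<^sup>2 - A * t - K) - D * t"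
  assumes K: "K > 0" and D: "D > 0"
    and Q: "Q x = 0" "Q y = 0" "x > y"
    and g: "g u = 0" "g v = 0" "g w = 0" and ord: "u > v" "v > w" "u > x"
  shows "x > v" "v > y" "y > w" "x * y = - K"
proof -
  have "(x - y) * (x + y - A) = 0" using Q unfolding Q_def by (simp add: algebra_simps power2_eq_square)
  hence "y = A - x" using Q(3) by simp
  thus xy: "x * y = - K" using Q(1) unfolding Q_def by algebra
  have pos: "x > 0" "y < 0"
    using xy K Q(3) by (smt (verit) mult_nonneg_nonneg mult_nonpos_nonpos)+
  have fac: "g t = (t - u) * (t - v) * (t - w)" for t
  proof (rule cubic_factors[where g = g, OF _ g])
    show "g t = t ^ 3 + (- m - A) * t\<^sup>2 + (m * A - K - D) * t + m * K" for t
      unfolding g_def by (simp add: algebra_simps power2_eq_square power3_eq_cube)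
  qed (use ord in auto)
  have "g x = - D * x" "g y = - D * y" using Q unfolding g_def Q_def by simp_all
  hence "g x < 0" "g y > 0" using pos D by (simp_all add: mult_pos_neg)
  hence 1: "(u - x) * ((x - v) * (x - w)) > 0" "(u - y) * ((y - v) * (y - w)) < 0"
    unfolding fac by (simp_all add: algebra_simps)
  hence 2: "(x - v) * (x - w) > 0" "(y - v) * (y - w) < 0"
    using ord Q(3) by (simp_all add: zero_less_mult_iff mult_less_0_iff)
  thus "v > y" "y > w" using ord(2) by (auto simp: mult_less_0_iff)
  thus "x > v" using 2 Q(3) by (auto simp: zero_less_mult_iff)
qed

text \<open>Five distinct numbers, each a root of a quadratic or of a cubic, use up all the roots of both.
  Among the six ways of distributing \<open>t 1, \<dots>, t 4\<close>, only one agrees with the interlacing pattern.\<close>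

lemma eigenvalue_order:
  fixes A K D m :: real and t :: "nat \<Rightarrow> real"
  defines "Q \<equiv> \<lambda>t. t\<^sup>2 - A * t - K" and "g \<equiv> \<lambda>t. (t - m) * (t\<^sup>2 - A * t - K) - D * t"
  assumes K: "K > 0" and D: "D > 0"
    and desc: "t 0 > t 1" "t 1 > t 2" "t 2 > t 3" "t 3 > t 4"
    and root: "\<And>i. i \<le> 4 \<Longrightarrow> Q (t i) = 0 \<or> g (t i) = 0" and Q0: "Q (t 0) \<noteq> 0"
  shows "Q (t 1) = 0" "g (t 4) = 0" "t 1 * t 3 = - K"
proof -
  have two: "False" if "Q x = 0" "Q y = 0" "Q z = 0" "x \<noteq> y" "y \<noteq> z" "x \<noteq> z" for x y z
    using quadratic_three_roots[of 1 x "- A" "- K" y z] that unfolding Q_def by simp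
  have three: "False" if "g x = 0" "g y = 0" "g z = 0" "g u = 0" "u < z" "z < y" "y < x" for x y z u
  proof -
    have "g u = (u - x) * (u - y) * (u - z)"
    proof (rule cubic_factors[where g = g, OF _ that(1-3)])
      show "g t = t ^ 3 + (- m - A) * t\<^sup>2 + (m * A - K - D) * t + m * K" for t
        unfolding g_def by (simp add: algebra_simps power2_eq_square power3_eq_cube)
    qed (use that in auto)
    thus False using that by simp
  qed
  have I: "x > v" "v > y" "y > w" "x * y = - K"
    if "Q x = 0" "Q y = 0" "x > y" "g u = 0" "g v = 0" "g w = 0" "u > v" "v > w" "u > x" for x y u v w
    using interlacing[OF K D, of x A y u m v w] that unfolding Q_def g_def by simp_all
  have g0: "g (t 0) = 0" using root[of 0] Q0 by simp
  have main: "Q (t 1) = 0 \<and> g (t 4) = 0 \<and> t 1 * t 3 = - K"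
  proof -
    have r: "Q (t 1) = 0 \<or> g (t 1) = 0" "Q (t 2) = 0 \<or> g (t 2) = 0"
      "Q (t 3) = 0 \<or> g (t 3) = 0" "Q (t 4) = 0 \<or> g (t 4) = 0" using root by auto
    consider (a) "Q (t 1) = 0" "Q (t 2) = 0" "g (t 3) = 0" "g (t 4) = 0"
      | (b) "Q (t 1) = 0" "g (t 2) = 0" "Q (t 3) = 0" "g (t 4) = 0"
      | (c) "Q (t 1) = 0" "g (t 2) = 0" "g (t 3) = 0" "Q (t 4) = 0"
      | (d) "g (t 1) = 0" "Q (t 2) = 0" "Q (t 3) = 0" "g (t 4) = 0"
      | (e) "g (t 1) = 0" "Q (t 2) = 0" "g (t 3) = 0" "Q (t 4) = 0"
      | (f) "g (t 1) = 0" "g (t 2) = 0" "Q (t 3) = 0" "Q (t 4) = 0"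
      using r two[of "t 1" "t 2" "t 3"] two[of "t 1" "t 2" "t 4"] two[of "t 1" "t 3" "t 4"]
        two[of "t 2" "t 3" "t 4"] three[OF g0, of "t 1" "t 2" "t 3"] three[OF g0, of "t 1" "t 2" "t 4"]
        three[OF g0, of "t 1" "t 3" "t 4"] three[OF g0, of "t 2" "t 3" "t 4"] desc
      by (smt (verit))
    thus ?thesis
    proof cases
      case a thus ?thesis using I(2)[of "t 1" "t 2" "t 0" "t 3" "t 4"] g0 desc by simp
    next
      case b thus ?thesis using I(4)[of "t 1" "t 3" "t 0" "t 2" "t 4"] g0 desc by simp
    next
      case c thus ?thesis using I(3)[of "t 1" "t 4" "t 0" "t 2" "t 3"] g0 desc by simp
    next
      case d thus ?thesis using I(1)[of "t 2" "t 3" "t 0" "t 1" "t 4"] g0 desc by simp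
    next
      case e thus ?thesis using I(1)[of "t 2" "t 4" "t 0" "t 1" "t 3"] g0 desc by simp
    next
      case f thus ?thesis using I(1)[of "t 3" "t 4" "t 0" "t 1" "t 2"] g0 desc by simp
    qed
  qed
  thus "Q (t 1) = 0" "g (t 4) = 0" "t 1 * t 3 = - K" by auto
qed

section \<open>Parameters of a tight antipodal graph of diameter four\<close>

locale tight_antipodal_4 = antipodal_diameter_4 +
  fixes \<theta> :: "nat \<Rightarrow> real"
  assumes \<theta>_desc: "\<theta> 0 > \<theta> 1" "\<theta> 1 > \<theta> 2" "\<theta> 2 > \<theta> 3" "\<theta> 3 > \<theta> 4"
    and \<theta>_eigen: "i \<le> 4 \<Longrightarrow> \<exists>f. eigenfunction (\<theta> i) f \<and> (\<exists>x\<in>V. f x \<noteq> 0)"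
    and \<theta>_0: "\<theta> 0 = real (b 0)"
    and tight: "(\<theta> 1 + real (b 0) / (real (a 1) + 1)) * (\<theta> 4 + real (b 0) / (real (a 1) + 1)) =
      - (real (b 0) * real (a 1) * real (b 1) / (real (a 1) + 1)\<^sup>2)"
begin

text \<open>These turn out to be the number \<open>q\<close> for which \<open>- q\<close> is the smallest local eigenvalue, and the
  nontrivial local eigenvalue \<open>p\<close>.\<close>

definition q :: real where "q = \<theta> 1 - a1"
definition p :: real where "p = a1 / (q + 1)"

lemma eigenvalue_roots:
  shows Q_\<theta>1: "(\<theta> 1)\<^sup>2 - a1 * \<theta> 1 - k = 0"
    and g_\<theta>4: "(\<theta> 4 - (k - real r * c2)) * ((\<theta> 4)\<^sup>2 - a1 * \<theta> 4 - k) = real r * c2 * b1 * \<theta> 4"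
    and \<theta>1_\<theta>3: "\<theta> 1 * \<theta> 3 = - k"
proof -
  have root: "(\<theta> i)\<^sup>2 - a1 * \<theta> i - k = 0 \<or>
    (\<theta> i - (k - real r * c2)) * ((\<theta> i)\<^sup>2 - a1 * \<theta> i - k) - (real r * c2 * b1) * \<theta> i = 0"
    if "i \<le> 4" for i
    using \<theta>_eigen[OF that] eigenvalue_cases[of "\<theta> i"] by fastforce
  have "(\<theta> 0)\<^sup>2 - a1 * \<theta> 0 - k = k * b1"
    using \<theta>_0 k_eq by (simp add: k_def power2_eq_square algebra_simps)
  hence Q0: "(\<theta> 0)\<^sup>2 - a1 * \<theta> 0 - k \<noteq> 0" using k_pos b1_pos by simp
  have D: "real r * c2 * b1 > 0" using r_ge_2 c2_pos b1_pos by simp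
  note * = eigenvalue_order[OF k_pos D \<theta>_desc root Q0]
  show "(\<theta> 1)\<^sup>2 - a1 * \<theta> 1 - k = 0" by (rule *(1))
  show "(\<theta> 4 - (k - real r * c2)) * ((\<theta> 4)\<^sup>2 - a1 * \<theta> 4 - k) = real r * c2 * b1 * \<theta> 4"
    using *(2) by simp
  show "\<theta> 1 * \<theta> 3 = - k" by (rule *(3))
qed

lemma \<theta>1_pos: "\<theta> 1 > 0"
proof -
  have "\<theta> 1 * \<theta> 3 < 0" using \<theta>1_\<theta>3 k_pos by simp
  thus ?thesis using \<theta>_desc(2,3) by (auto simp: mult_less_0_iff)
qed

lemma k_\<theta>1: "k = q * \<theta> 1"
  using Q_\<theta>1 by (simp add: q_def power2_eq_square algebra_simps)

lemma b1_\<theta>1: "b1 = (q - 1) * (\<theta> 1 + 1)"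
proof -
  have "\<theta> 1 = q + a1" by (simp add: q_def)
  thus ?thesis using k_\<theta>1 k_eq by (simp add: algebra_simps)
qed

lemma q_gt_1: "q > 1"
  using b1_\<theta>1 b1_pos \<theta>1_pos by (metis add_pos_pos diff_gt_0_iff_gt zero_less_mult_pos2 zero_less_one)

lemma p_nonneg: "p \<ge> 0"
  using a1_nonneg q_gt_1 by (simp add: p_def)

lemma a1_pq: "a1 = p * (q + 1)"
  using q_gt_1 by (simp add: p_def)

lemma \<theta>1_pq: "\<theta> 1 = p * q + p + q"
  using a1_pq by (simp add: q_def algebra_simps)

lemma k_pq: "k = q * (p * q + p + q)"
  using k_\<theta>1 \<theta>1_pq by simp

lemma b1_pq: "b1 = (q\<^sup>2 - 1) * (p + 1)"
  using b1_\<theta>1 \<theta>1_pq by (simp add: algebra_simps power2_eq_square)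

text \<open>Since \<open>\<theta> 1\<close> is a root of the quadratic, \<open>\<theta> 1 * (a1 + 1) + k = \<theta> 1 * (\<theta> 1 + 1)\<close>; this factor
  cancels in the equation of tightness, which becomes linear in \<open>\<theta> 4\<close>.\<close>

lemma \<theta>4_pq: "\<theta> 4 = - (q\<^sup>2)"
proof -
  let ?s = "a1 + 1"
  have s: "?s > 0" using a1_nonneg by simp
  have "(\<theta> 1 + k / ?s) * (\<theta> 4 + k / ?s) = - (k * a1 * b1 / ?s\<^sup>2)"
    using tight by (simp add: k_def a1_def b1_def)
  hence "(\<theta> 1 + k / ?s) * (\<theta> 4 + k / ?s) * ?s\<^sup>2 = - (k * a1 * b1)" using s by simp
  moreover have "(\<theta> 1 + k / ?s) * (\<theta> 4 + k / ?s) * ?s\<^sup>2 =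
      ((\<theta> 1 + k / ?s) * ?s) * ((\<theta> 4 + k / ?s) * ?s)"
    by (simp add: power2_eq_square)
  moreover have "(\<theta> 1 + k / ?s) * ?s = \<theta> 1 * ?s + k" "(\<theta> 4 + k / ?s) * ?s = \<theta> 4 * ?s + k"
    using s by (simp_all add: distrib_right)
  ultimately have *: "(\<theta> 1 * ?s + k) * (\<theta> 4 * ?s + k) = - (k * a1 * b1)" by simp
  have "\<theta> 1 * ?s + k = \<theta> 1 * (\<theta> 1 + 1)"
    unfolding k_\<theta>1 by (simp add: q_def algebra_simps)
  hence "(\<theta> 1 * (\<theta> 1 + 1)) * (\<theta> 4 * ?s + k) = (\<theta> 1 * (\<theta> 1 + 1)) * (- (q * a1 * (q - 1)))"
    using * unfolding k_\<theta>1 b1_\<theta>1 by (simp add: algebra_simps)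
  moreover have "\<theta> 1 * (\<theta> 1 + 1) \<noteq> 0" using \<theta>1_pos by auto
  ultimately have "\<theta> 4 * ?s + k = - (q * a1 * (q - 1))" using mult_left_cancel by blast
  hence "?s * \<theta> 4 = ?s * - (q\<^sup>2)"
    unfolding k_\<theta>1 by (simp add: q_def algebra_simps power2_eq_square)
  moreover have "?s \<noteq> 0" using s by simp
  ultimately show ?thesis using mult_left_cancel by blast
qed

lemma r_c2: "real r * c2 = q * (p + q)"
proof -
  let ?C = "real r * c2"
  have 1: "(\<theta> 4)\<^sup>2 - a1 * \<theta> 4 - k = q * (q\<^sup>2 - 1) * (p + q)"
    unfolding \<theta>4_pq a1_pq k_pq by (simp add: algebra_simps power2_eq_square)
  have "(- (q\<^sup>2) - (k - ?C)) * (q * (q\<^sup>2 - 1) * (p + q)) = ?C * ((q\<^sup>2 - 1) * (p + 1)) * - (q\<^sup>2)"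
    using g_\<theta>4 unfolding 1 unfolding \<theta>4_pq b1_pq by simp
  hence "(q * (q\<^sup>2 - 1)) * (((?C - k - q\<^sup>2) * (p + q)) + ?C * (p + 1) * q) = 0"
    by (simp add: algebra_simps power2_eq_square)
  moreover have "q * (q\<^sup>2 - 1) \<noteq> 0" using q_gt_1 by (simp add: power2_eq_1_iff)
  ultimately have "((?C - k - q\<^sup>2) * (p + q)) + ?C * (p + 1) * q = 0" by simp
  hence "(p * q + p + 2 * q) * ?C = (p * q + p + 2 * q) * (q * (p + q))"
    unfolding k_pq by (simp add: algebra_simps power2_eq_square)
  moreover have "p * q + p + 2 * q > 0" using p_nonneg q_gt_1 by (simp add: add_nonneg_pos)
  ultimately show ?thesis by (metis less_irrefl mult_left_cancel)
qed

text \<open>The cosine sequences of \<open>\<theta> 1\<close> and \<open>\<theta> 4\<close>.  An eigenfunction for \<open>\<theta> 1\<close> has sum zero on antipodal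
  classes, whence \<open>u 2 = 0\<close> and the factors \<open>- 1 / (r - 1)\<close>; one for \<open>\<theta> 4\<close> is constant on them, whence
  the symmetry of \<open>w\<close>.\<close>

definition u :: "nat \<Rightarrow> real" where
  "u i = (if i = 0 then 1 else if i = 1 then 1 / q else if i = 2 then 0
     else if i = 3 then - 1 / (q * (real r - 1)) else - 1 / (real r - 1))"

definition w1 :: real where "w1 = - q / \<theta> 1"
definition w2 :: real where "w2 = (p + q) / ((p + 1) * \<theta> 1)"

definition w :: "nat \<Rightarrow> real" where
  "w i = (if i = 0 \<or> i = 4 then 1 else if i = 2 then w2 else w1)"

lemma c_0': "c 0 = 0"
  using c_0 V_nonempty by simp

lemma radial_values:
  "radial v 0 = k * v 1"
  "radial v 1 = v 0 + a1 * v 1 + b1 * v 2"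
  "radial v 2 = c2 * v 1 + (k - real r * c2) * v 2 + (real r - 1) * c2 * v 3"
  "radial v 3 = b1 * v 2 + a1 * v 3 + v 4"
  "radial v 4 = k * v 3"
proof -
  have [simp]: "a 0 = 0" "c 0 = 0" "c (Suc 0) = 1" "c 3 = b 1" "a 3 = a 1" "b 3 = 1" "b 4 = 0" "a 4 = 0" "c 4 = b 0"
    using a_0 c_0' c_1 c_3 a_3 b_3 b_4 a_4 c_4 by simp_all
  show "radial v 0 = k * v 1" by (simp add: radial_def k_def)
  show "radial v 1 = v 0 + a1 * v 1 + b1 * v 2" by (simp add: radial_def a1_def b1_def numeral_2_eq_2)
  show "radial v 2 = c2 * v 1 + (k - real r * c2) * v 2 + (real r - 1) * c2 * v 3"
    using real_a_2 real_b_2 by (simp add: radial_def c2_def)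
  show "radial v 3 = b1 * v 2 + a1 * v 3 + v 4" by (simp add: radial_def a1_def b1_def)
  show "radial v 4 = k * v 3" by (simp add: radial_def k_def)
qed

lemma le_4_cases: "i \<le> 4 \<Longrightarrow> i = 0 \<or> i = 1 \<or> i = 2 \<or> i = 3 \<or> i = (4::nat)"
  by arith

lemma radial_u: "i \<le> 4 \<Longrightarrow> radial u i = \<theta> 1 * u i"
proof -
  assume i: "i \<le> 4"
  have nz: "q \<noteq> 0" "real r - 1 \<noteq> 0" using q_gt_1 r_ge_2 by auto
  have *: "1 + a1 / q = \<theta> 1 / q" using nz by (simp add: q_def field_simps)
  hence **: "q + a1 = \<theta> 1" by (simp add: q_def)
  show ?thesis using le_4_cases[OF i]
  proof (elim disjE)
    assume [simp]: "i = 0" show ?thesis using nz k_\<theta>1 unfolding \<open>i = 0\<close> radial_values by (simp add: u_def)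
  next
    assume "i = 1" show ?thesis using nz * unfolding \<open>i = 1\<close> radial_values by (simp add: u_def)
  next
    assume "i = 2" show ?thesis using nz unfolding \<open>i = 2\<close> radial_values by (simp add: u_def)
  next
    assume "i = 3"
    have "a1 * (- 1 / (q * s)) + (- 1 / s) = (q + a1) * (- 1 / (q * s))" if "s \<noteq> 0" for s
      using nz(1) that by (simp add: field_simps)
    from this[OF nz(2)] show ?thesis unfolding \<open>i = 3\<close> radial_values ** by (simp add: u_def)
  next
    assume "i = 4" show ?thesis using nz k_\<theta>1 unfolding \<open>i = 4\<close> radial_values by (simp add: u_def)
  qed
qed

lemma radial_w: "i \<le> 4 \<Longrightarrow> radial w i = \<theta> 4 * w i"
proof -
  assume i: "i \<le> 4"
  have nz: "\<theta> 1 \<noteq> 0" "p + 1 \<noteq> 0" using \<theta>1_pos p_nonneg by auto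
  have w1: "\<theta> 1 * w1 = - q" using nz by (simp add: w1_def)
  have w2: "\<theta> 1 * w2 * (p + 1) = p + q" using nz by (simp add: w2_def)
  have k1: "k * w1 = \<theta> 4" using w1 unfolding k_\<theta>1 \<theta>4_pq by (simp add: power2_eq_square mult_ac)
  have "\<theta> 1 * (1 + a1 * w1 + b1 * w2) = \<theta> 1 + a1 * (\<theta> 1 * w1) + (q\<^sup>2 - 1) * (\<theta> 1 * w2 * (p + 1))"
    unfolding b1_pq by (simp add: algebra_simps)
  also have "\<dots> = \<theta> 4 * (\<theta> 1 * w1)"
    unfolding w1 w2 unfolding \<theta>4_pq a1_pq \<theta>1_pq by (simp add: algebra_simps power2_eq_square)
  finally have 1: "1 + a1 * w1 + b1 * w2 = \<theta> 4 * w1" using nz by simp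
  have "\<theta> 1 * (p + 1) * (real r * c2 * w1 + (k - real r * c2 - \<theta> 4) * w2) =
      real r * c2 * (p + 1) * (\<theta> 1 * w1) + (k - real r * c2 - \<theta> 4) * (\<theta> 1 * w2 * (p + 1))"
    by (simp add: algebra_simps)
  also have "\<dots> = 0"
    unfolding w1 w2 unfolding r_c2 k_pq \<theta>4_pq by (simp add: algebra_simps power2_eq_square)
  finally have 2: "real r * c2 * w1 + (k - real r * c2 - \<theta> 4) * w2 = 0" using nz by simp
  show ?thesis using le_4_cases[OF i]
  proof (elim disjE)
    assume "i = 0" show ?thesis using k1 unfolding \<open>i = 0\<close> radial_values by (simp add: w_def)
  next
    assume "i = 1" show ?thesis using 1 unfolding \<open>i = 1\<close> radial_values by (simp add: w_def)
  next
    assume "i = 2" show ?thesis using 2 unfolding \<open>i = 2\<close> radial_values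
      by (simp add: w_def algebra_simps)
  next
    assume "i = 3" show ?thesis using 1 unfolding \<open>i = 3\<close> radial_values by (simp add: w_def)
  next
    assume "i = 4" show ?thesis using k1 unfolding \<open>i = 4\<close> radial_values by (simp add: w_def)
  qed
qed

lemma u_vals: "u 0 = 1" "u 1 = 1 / q" "u 2 = 0"
  by (simp_all add: u_def)

lemma w_vals: "w 0 = 1" "w 1 = w1" "w 2 = w2"
  by (simp_all add: w_def)

text \<open>The relations between the entries of \<open>w\<close> that convert cosines into local
  eigenvalues: the first one makes \<open>w\<close> on a local graph a combination of \<open>J\<close> and \<open>A - p I\<close>.\<close>

lemma w_gap: "1 - w2 = - p * (w1 - w2)" "(w1 - w2) * (p + q) = - w2 * (\<theta> 1 + q)" "w1 \<noteq> w2"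
proof -
  have nz: "\<theta> 1 \<noteq> 0" "p + 1 \<noteq> 0" using \<theta>1_pos p_nonneg by auto
  have w1: "\<theta> 1 * w1 = - q" using nz by (simp add: w1_def)
  have w2: "\<theta> 1 * w2 * (p + 1) = p + q" using nz by (simp add: w2_def)
  have "\<theta> 1 * (p + 1) * (1 - w2 + p * (w1 - w2)) =
      \<theta> 1 * (p + 1) - \<theta> 1 * w2 * (p + 1) + p * ((p + 1) * (\<theta> 1 * w1) - \<theta> 1 * w2 * (p + 1))"
    by (simp add: algebra_simps)
  also have "\<dots> = 0" unfolding w1 w2 unfolding \<theta>1_pq by (simp add: algebra_simps)
  finally show "1 - w2 = - p * (w1 - w2)" using nz by simp
  have "\<theta> 1 * (p + 1) * ((w1 - w2) * (p + q) + w2 * (\<theta> 1 + q)) =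
      ((p + 1) * (\<theta> 1 * w1) - \<theta> 1 * w2 * (p + 1)) * (p + q) + \<theta> 1 * w2 * (p + 1) * (\<theta> 1 + q)"
    by (simp add: algebra_simps)
  also have "\<dots> = 0" unfolding w1 w2 unfolding \<theta>1_pq by (simp add: algebra_simps)
  finally have "(w1 - w2) * (p + q) + w2 * (\<theta> 1 + q) = 0" using nz by simp
  thus "(w1 - w2) * (p + q) = - w2 * (\<theta> 1 + q)" by simp
  have "w1 < 0" "w2 > 0" using \<theta>1_pos q_gt_1 p_nonneg by (simp_all add: w1_def w2_def)
  thus "w1 \<noteq> w2" by simp
qed

lemma w1_sq: "\<theta> 1 * (w1\<^sup>2 - w2) = p * (w1 - w2)"
proof -
  have nz: "\<theta> 1 \<noteq> 0" "p + 1 \<noteq> 0" using \<theta>1_pos p_nonneg by auto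
  have w1: "\<theta> 1 * w1 = - q" using nz by (simp add: w1_def)
  have w2: "\<theta> 1 * w2 * (p + 1) = p + q" using nz by (simp add: w2_def)
  have "\<theta> 1 * (p + 1) * (\<theta> 1 * (w1\<^sup>2 - w2) - p * (w1 - w2)) =
     (p + 1) * (\<theta> 1 * w1)\<^sup>2 - \<theta> 1 * (\<theta> 1 * w2 * (p + 1)) - p * ((p + 1) * (\<theta> 1 * w1) - \<theta> 1 * w2 * (p + 1))"
    by (simp add: algebra_simps power2_eq_square)
  also have "\<dots> = 0" unfolding w1 w2 unfolding \<theta>1_pq by (simp add: algebra_simps power2_eq_square)
  finally show ?thesis using nz by simp
qed

end

section \<open>Local consequences of tightness\<close>

text \<open>Subtracting \<open>u 1 * u (d z x)\<close> from \<open>u (d z t)\<close> removes the mean over the neighbours \<open>t\<close> of \<open>x\<close>.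
  The Gram matrix of the resulting columns is again a function of the distance.\<close>

lemma (in distance_regular_metric) centred_gram:
  fixes u :: "nat \<Rightarrow> real"
  assumes sq: "\<And>y z. y \<in> V \<Longrightarrow> z \<in> V \<Longrightarrow> (\<Sum>v\<in>V. u (d y v) * u (d v z)) = C * u (d y z)"
    and u0: "u 0 = 1" and x: "x \<in> V" and t: "t \<in> N x" "t' \<in> N x"
  shows "(\<Sum>z\<in>V. (u (d z t) - u 1 * u (d z x)) * (u (d z t') - u 1 * u (d z x))) =
    C * (u (d t t') - (u 1)\<^sup>2)"
proof -
  have gram: "(\<Sum>z\<in>V. u (d z s) * u (d z s')) = C * u (d s s')" if "s \<in> V" "s' \<in> V" for s s'
  proof -
    have "(\<Sum>z\<in>V. u (d z s) * u (d z s')) = (\<Sum>z\<in>V. u (d s z) * u (d z s'))"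
      using that by (intro sum.cong) (auto simp: d_sym)
    thus ?thesis using sq that by simp
  qed
  have V: "t \<in> V" "t' \<in> V" "d t x = 1" "d t' x = 1" "d x x = 0" "d x t' = 1"
    using t x d_sym d_eq_0 by (auto simp: N_iff)
  have "(\<Sum>z\<in>V. (u (d z t) - u 1 * u (d z x)) * (u (d z t') - u 1 * u (d z x))) =
    (\<Sum>z\<in>V. u (d z t) * u (d z t')) - u 1 * (\<Sum>z\<in>V. u (d z t) * u (d z x))
     - u 1 * (\<Sum>z\<in>V. u (d z t') * u (d z x)) + (u 1)\<^sup>2 * (\<Sum>z\<in>V. u (d z x) * u (d z x))"
    unfolding sum_distrib_left sum_subtractf[symmetric] sum.distrib[symmetric]
    by (intro sum.cong refl) (simp add: algebra_simps power2_eq_square)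
  also have "\<dots> = C * (u (d t t') - (u 1)\<^sup>2)"
    using gram V x by (simp add: u0 algebra_simps power2_eq_square)
  finally show ?thesis .
qed

text \<open>For matrices with columns indexed by \<open>D\<close> this is
  \<open>\<parallel>f g\<^sup>T\<parallel>\<^sup>2 = tr (f\<^sup>T f g\<^sup>T g)\<close> in the Frobenius norm.\<close>

lemma sum_product_swap:
  fixes f g :: "'a \<Rightarrow> 'b \<Rightarrow> real"
  shows "(\<Sum>z\<in>V. \<Sum>z'\<in>V. (\<Sum>t\<in>D. f z t * g z' t)\<^sup>2) =
    (\<Sum>t\<in>D. \<Sum>t'\<in>D. (\<Sum>z\<in>V. f z t * f z t') * (\<Sum>z\<in>V. g z t * g z t'))"
proof -
  have "(\<Sum>z\<in>V. \<Sum>z'\<in>V. (\<Sum>t\<in>D. f z t * g z' t)\<^sup>2) =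
    (\<Sum>z\<in>V. \<Sum>z'\<in>V. \<Sum>t\<in>D. \<Sum>t'\<in>D. (f z t * f z t') * (g z' t * g z' t'))"
    unfolding power2_eq_square sum_product by (intro sum.cong refl) simp
  also have "\<dots> = (\<Sum>z\<in>V. \<Sum>t\<in>D. \<Sum>z'\<in>V. \<Sum>t'\<in>D. (f z t * f z t') * (g z' t * g z' t'))"
    by (intro sum.cong refl sum.swap)
  also have "\<dots> = (\<Sum>t\<in>D. \<Sum>z\<in>V. \<Sum>z'\<in>V. \<Sum>t'\<in>D. (f z t * f z t') * (g z' t * g z' t'))"
    by (rule sum.swap)
  also have "\<dots> = (\<Sum>t\<in>D. \<Sum>z\<in>V. \<Sum>t'\<in>D. \<Sum>z'\<in>V. (f z t * f z t') * (g z' t * g z' t'))"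
    by (intro sum.cong refl sum.swap)
  also have "\<dots> = (\<Sum>t\<in>D. \<Sum>t'\<in>D. \<Sum>z\<in>V. \<Sum>z'\<in>V. (f z t * f z t') * (g z' t * g z' t'))"
    by (intro sum.cong refl sum.swap)
  also have "\<dots> = (\<Sum>t\<in>D. \<Sum>t'\<in>D. (\<Sum>z\<in>V. f z t * f z t') * (\<Sum>z\<in>V. g z t * g z t'))"
    by (simp add: sum_product)
  finally show ?thesis .
qed

context tight_antipodal_4
begin

lemma c_ne_0: "i < 4 \<Longrightarrow> c (Suc i) \<noteq> 0"
  using c_pos by force

text \<open>The main consequence of tightness.  By the previous lemma the sum of the squares of all these
  numbers is a multiple of the trace of a product of two centred Gram matrices on \<open>N x\<close>.  The row
  sums of the entrywise product are \<open>radial h 1\<close>, which vanishes for \<open>\<theta> 1\<close> and \<open>\<theta> 4\<close> because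
  \<open>u 1 * w 1 = - 1 / \<theta> 1\<close>.\<close>

lemma local_orthogonality:
  assumes x: "x \<in> V" and z: "z \<in> V" "z' \<in> V"
  shows "(\<Sum>t\<in>N x. (u (d z t) - u 1 * u (d z x)) * (w (d z' t) - w 1 * w (d z' x))) = 0"
proof -
  obtain C where C: "\<And>y z. y \<in> V \<Longrightarrow> z \<in> V \<Longrightarrow> (\<Sum>v\<in>V. u (d y v) * u (d v z)) = C * u (d y z)"
    using cosine_matrix_square[of 4 u "\<theta> 1", OF c_ne_0 diam radial_u _ V_nonempty] u_vals by metis
  obtain C' where C': "\<And>y z. y \<in> V \<Longrightarrow> z \<in> V \<Longrightarrow> (\<Sum>v\<in>V. w (d y v) * w (d v z)) = C' * w (d y z)"
    using cosine_matrix_square[of 4 w "\<theta> 4", OF c_ne_0 diam radial_w _ V_nonempty] w_vals by metis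
  let ?f = "\<lambda>z t. u (d z t) - u 1 * u (d z x)"
  let ?g = "\<lambda>z t. w (d z t) - w 1 * w (d z x)"
  define h where "h i = (u i - (u 1)\<^sup>2) * (w i - (w 1)\<^sup>2)" for i
  have "\<theta> 1 * w1 = - q" using \<theta>1_pos by (simp add: w1_def)
  hence uw: "u 1 * w 1 = - 1 / \<theta> 1" using q_gt_1 \<theta>1_pos unfolding u_vals w_vals by (simp add: field_simps)
  have kw: "\<theta> 4 * w 1 = k * w 1 * w 1" "\<theta> 1 * u 1 = k * u 1 * u 1"
    using radial_u[of 0] radial_w[of 0] unfolding radial_values by (simp_all add: u_vals w_vals)
  have "radial h 1 = u 0 * w 0 + a1 * (u 1 * w 1) + b1 * (u 2 * w 2)
      - (u 1)\<^sup>2 * (w 0 + a1 * w 1 + b1 * w 2) - (w 1)\<^sup>2 * (u 0 + a1 * u 1 + b1 * u 2)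
      + (1 + a1 + b1) * ((u 1)\<^sup>2 * (w 1)\<^sup>2)"
    unfolding radial_values h_def by (simp add: algebra_simps)
  also have "\<dots> = 1 + a1 * (u 1 * w 1) - (u 1)\<^sup>2 * (\<theta> 4 * w 1) - (w 1)\<^sup>2 * (\<theta> 1 * u 1) + k * ((u 1)\<^sup>2 * (w 1)\<^sup>2)"
    using radial_u[of 1] radial_w[of 1] unfolding radial_values k_eq[symmetric] by (simp add: u_vals w_vals)
  also have "\<dots> = 1 + a1 * (u 1 * w 1) - k * (u 1 * w 1)\<^sup>2"
    unfolding kw by (simp add: algebra_simps power2_eq_square)
  also have "\<dots> = ((\<theta> 1)\<^sup>2 - a1 * \<theta> 1 - k) / (\<theta> 1)\<^sup>2"
    unfolding uw using \<theta>1_pos by (simp add: field_simps power2_eq_square)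
  finally have h0: "radial h 1 = 0" using Q_\<theta>1 by simp
  have "(\<Sum>z\<in>V. \<Sum>z'\<in>V. (\<Sum>t\<in>N x. ?f z t * ?g z' t)\<^sup>2) =
    (\<Sum>t\<in>N x. \<Sum>t'\<in>N x. (\<Sum>z\<in>V. ?f z t * ?f z t') * (\<Sum>z\<in>V. ?g z t * ?g z t'))"
    by (rule sum_product_swap)
  also have "\<dots> = (\<Sum>t\<in>N x. \<Sum>t'\<in>N x. (C * C') * h (d t t'))"
  proof (intro sum.cong refl)
    fix t t' assume t: "t \<in> N x" "t' \<in> N x"
    have "(\<Sum>z\<in>V. ?f z t * ?f z t') = C * (u (d t t') - (u 1)\<^sup>2)"
      using C by (intro centred_gram u_vals x t)
    moreover have "(\<Sum>z\<in>V. ?g z t * ?g z t') = C' * (w (d t t') - (w 1)\<^sup>2)"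
      using C' by (intro centred_gram w_vals x t)
    ultimately show "(\<Sum>z\<in>V. ?f z t * ?f z t') * (\<Sum>z\<in>V. ?g z t * ?g z t') = C * C' * h (d t t')"
      by (simp only: h_def mult_ac)
  qed
  also have "\<dots> = (\<Sum>t\<in>N x. (C * C') * radial h (d t x))"
    by (intro sum.cong refl) (use x in \<open>simp add: sum_N_radial N_iff flip: sum_distrib_left\<close>)
  also have "\<dots> = 0"
    by (intro sum.neutral ballI) (use x d_sym h0 in \<open>auto simp: N_iff\<close>)
  finally have "(\<Sum>z\<in>V. \<Sum>z'\<in>V. (\<Sum>t\<in>N x. ?f z t * ?g z' t)\<^sup>2) = 0" .
  hence "\<forall>z\<in>V. (\<Sum>z'\<in>V. (\<Sum>t\<in>N x. ?f z t * ?g z' t)\<^sup>2) = 0"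
    using finite_V by (subst (asm) sum_nonneg_eq_0_iff) (auto intro: sum_nonneg)
  hence "(\<Sum>z'\<in>V. (\<Sum>t\<in>N x. ?f z t * ?g z' t)\<^sup>2) = 0" using z by blast
  hence "(\<Sum>t\<in>N x. ?f z t * ?g z' t)\<^sup>2 = 0"
    using finite_V z by (subst (asm) sum_nonneg_eq_0_iff) auto
  thus ?thesis by simp
qed

lemma sum_u: "x \<in> V \<Longrightarrow> z \<in> V \<Longrightarrow> (\<Sum>t\<in>N x. u (d z t)) = \<theta> 1 * u (d z x)"
  using sum_N_radial radial_u diam by simp

lemma sum_w: "x \<in> V \<Longrightarrow> z \<in> V \<Longrightarrow> (\<Sum>t\<in>N x. w (d z t)) = \<theta> 4 * w (d z x)"
  using sum_N_radial radial_w diam by simp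

lemma local_product:
  assumes x: "x \<in> V" and z: "z \<in> V" "z' \<in> V"
  shows "(\<Sum>t\<in>N x. u (d z t) * w (d z' t)) = \<theta> 1 * w 1 * (u (d z x) * w (d z' x))"
proof -
  have k: "\<theta> 1 * u (d z x) * (w 1 * w (d z' x)) = k * u 1 * w 1 * (u (d z x) * w (d z' x))"
    "real (card (N x)) = k" "\<theta> 4 = k * w 1"
    using radial_u[of 0] radial_w[of 0] card_N[OF x] unfolding radial_values by (simp_all add: u_vals w_vals k_def)
  have "(\<Sum>t\<in>N x. (u (d z t) - u 1 * u (d z x)) * (w (d z' t) - w 1 * w (d z' x))) =
    (\<Sum>t\<in>N x. u (d z t) * w (d z' t)) - (\<Sum>t\<in>N x. u (d z t)) * (w 1 * w (d z' x))
      - u 1 * u (d z x) * (\<Sum>t\<in>N x. w (d z' t)) + (\<Sum>t\<in>N x. u 1 * u (d z x) * (w 1 * w (d z' x)))"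
    unfolding sum_distrib_left sum_distrib_right sum_subtractf[symmetric] sum.distrib[symmetric]
    by (intro sum.cong refl) (simp add: algebra_simps)
  also have "\<dots> = (\<Sum>t\<in>N x. u (d z t) * w (d z' t)) - \<theta> 1 * w 1 * (u (d z x) * w (d z' x))"
    unfolding sum_u[OF x z(1)] sum_w[OF x z(2)] sum_constant k(2,3) by (simp add: algebra_simps)
  finally show ?thesis using local_orthogonality[OF assms] by simp
qed

definition A :: "'a \<Rightarrow> 'a \<Rightarrow> real" where "A s t = (if d s t = 1 then 1 else 0)"
definition I :: "'a \<Rightarrow> 'a \<Rightarrow> real" where "I s t = (if s = t then 1 else 0)"

lemma N_dist:
  assumes "x \<in> V" "s \<in> N x" "t \<in> N x"
  shows "d s t = 0 \<or> d s t = 1 \<or> d s t = 2"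
proof -
  have "d s t \<le> 2" using d_triangle[of s x t] d_sym[of s x] assms by (auto simp: N_iff)
  thus ?thesis by arith
qed

lemma u_local: "x \<in> V \<Longrightarrow> s \<in> N x \<Longrightarrow> t \<in> N x \<Longrightarrow> u (d s t) = I s t + A s t / q"
  using N_dist[of x s t] d_eq_0[of s t] u_vals by (auto simp: A_def I_def N_iff)

lemma w_local: "x \<in> V \<Longrightarrow> s \<in> N x \<Longrightarrow> t \<in> N x \<Longrightarrow> w (d s t) = w2 + (w1 - w2) * (A s t - p * I s t)"
proof -
  assume x: "x \<in> V" and st: "s \<in> N x" "t \<in> N x"
  have "w2 + (w1 - w2) * (- p) = 1" using w_gap(1) by (simp add: algebra_simps)
  thus ?thesis using N_dist[OF x st] d_eq_0[of s t] w_vals st by (auto simp: A_def I_def N_iff)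
qed

lemma A_sym: "s \<in> V \<Longrightarrow> t \<in> V \<Longrightarrow> A s t = A t s"
  by (simp add: A_def d_sym)

lemma sum_I [simp]: "finite D \<Longrightarrow> s \<in> D \<Longrightarrow> (\<Sum>t\<in>D. I s t * f t) = f s"
  by (simp add: I_def if_distrib[of "\<lambda>x. x * _"] sum.delta cong: if_cong)

lemma local_valency: "x \<in> V \<Longrightarrow> s \<in> N x \<Longrightarrow> (\<Sum>t\<in>N x. A s t) = p * (q + 1)"
proof -
  assume x: "x \<in> V" "s \<in> N x"
  have *: "s \<in> V" "d s x = 1" using x d_sym by (auto simp: N_iff)
  have "(\<Sum>t\<in>N x. A s t) = radial (\<lambda>i. if i = 1 then 1 else 0) 1"
    unfolding A_def using sum_N_radial[OF *(1) x(1), of "\<lambda>i. if i = 1 then 1 else 0"] *(2) by simp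
  thus ?thesis using a1_pq unfolding radial_values by simp
qed

text \<open>On \<open>N x\<close> the matrices of \<open>u\<close> and \<open>w\<close> are combinations of \<open>I + A / q\<close>, \<open>A - p I\<close> and \<open>J\<close>, so
  orthogonality says that \<open>(A + q I) (A - p I)\<close> is a multiple of \<open>J\<close>.\<close>

lemma local_strongly_regular:
  assumes x: "x \<in> V" and s: "s \<in> N x" "t \<in> N x"
  shows "(\<Sum>v\<in>N x. A s v * A v t) = (p - q) * A s t + p * q * I s t + p"
proof -
  have V: "s \<in> V" "t \<in> V" "d s x = 1" "d t x = 1" using x s d_sym by (auto simp: N_iff)
  have nz: "q \<noteq> 0" "w1 - w2 \<noteq> 0" using q_gt_1 w_gap(3) by auto
  let ?S = "\<Sum>v\<in>N x. A s v * A v t"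
  have Asum: "(\<Sum>v\<in>N x. A s v * I t v) = A s t"
    using sum_I[OF finite_N s(2), of "\<lambda>v. A s v"] by (simp add: mult.commute)
  have AA: "(\<Sum>v\<in>N x. A s v * A t v) = ?S"
    using A_sym V by (intro sum.cong) (auto simp: N_iff)
  have u_sum: "(\<Sum>v\<in>N x. I s v + A s v / q) = \<theta> 1 * u 1"
    using sum_u[OF x V(1)] V(3) u_local[OF x s(1)] by simp
  have "\<theta> 1 * w 1 * (u 1 * w 1) = (\<Sum>v\<in>N x. u (d s v) * w (d t v))"
    using local_product[OF x V(1,2)] V(3,4) by simp
  also have "\<dots> = (\<Sum>v\<in>N x. (I s v + A s v / q) * (w2 + (w1 - w2) * (A t v - p * I t v)))"
    using u_local[OF x s(1)] w_local[OF x s(2)] by simp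
  also have "\<dots> = w2 * (\<Sum>v\<in>N x. I s v + A s v / q) + (w1 - w2) * ((\<Sum>v\<in>N x. I s v * A t v) +
      (\<Sum>v\<in>N x. A s v * A t v) / q - p * (\<Sum>v\<in>N x. I s v * I t v) - p / q * (\<Sum>v\<in>N x. A s v * I t v))"
    unfolding sum_distrib_left sum_divide_distrib sum_subtractf[symmetric] sum.distrib[symmetric]
    by (intro sum.cong refl) (simp add: algebra_simps add_divide_distrib diff_divide_distrib)
  also have "\<dots> = w2 * (\<theta> 1 * u 1) + (w1 - w2) * (A s t + ?S / q - p * I s t - p / q * A s t)"
    unfolding u_sum AA Asum sum_I[OF finite_N s(1)] using A_sym[OF V(1,2)] by (simp add: I_def)
  finally have "\<theta> 1 * w 1 * (u 1 * w 1) - w2 * (\<theta> 1 * u 1) =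
    (w1 - w2) * (A s t + ?S / q - p * I s t - p / q * A s t)" by simp
  moreover have "\<theta> 1 * w 1 * (u 1 * w 1) - w2 * (\<theta> 1 * u 1) = (w1 - w2) * (p / q)"
    using w1_sq nz unfolding u_vals w_vals by (simp add: field_simps power2_eq_square)
  ultimately have "(w1 - w2) * (p / q) = (w1 - w2) * (A s t + ?S / q - p * I s t - p / q * A s t)"
    by (simp only:)
  hence "p / q = A s t + ?S / q - p * I s t - p / q * A s t"
    using nz(2) mult_left_cancel by blast
  also have "\<dots> = (q * A s t + ?S - p * q * I s t - p * A s t) / q"
    using nz(1) by (simp add: add_divide_distrib diff_divide_distrib)
  finally have "p = q * A s t + ?S - p * q * I s t - p * A s t" using nz(1) by simp
  thus ?thesis by (simp add: algebra_simps)
qed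

lemma F_eq:
  assumes "y \<in> V" "y' \<in> F y"
  shows "F y' = F y"
proof -
  have "F v \<subseteq> F z" if z: "z \<in> V" and v: "v \<in> F z" for v z
  proof
    fix s assume s: "s \<in> F v"
    have V: "v \<in> V" "s \<in> V" using v s F_V by auto
    show "s \<in> F z"
    proof (cases "s = z")
      case True
      thus ?thesis using F_self z by simp
    next
      case False
      hence "d s z = 4" using F_dist[OF V(1) s F_sym[OF z v]] by simp
      thus ?thesis using V d_sym[OF V(2) z] by (simp add: F_def)
    qed
  qed
  thus ?thesis using assms F_sym F_V by blast
qed

text \<open>As the members of an antipodal class have no common neighbours, on \<open>N x\<close> this is the indicator
  function of the union of the \<open>\<mu>\<close>-graphs of \<open>x\<close> and the members of the class.\<close>

definition U :: "'a \<Rightarrow> 'a \<Rightarrow> real" where "U y t = (\<Sum>y'\<in>F y. A y' t)"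

lemma U_1:
  assumes "y \<in> V" "y' \<in> F y" "t \<in> V" "d y' t = 1"
  shows "U y t = 1"
proof -
  have "U y t = (\<Sum>y''\<in>F y. if y'' = y' then 1 else 0)"
    unfolding U_def
  proof (intro sum.cong refl)
    fix y'' assume y'': "y'' \<in> F y"
    have "d y'' t = 1 \<longleftrightarrow> y'' = y'"
      using fibre_neighbour_unique[OF assms(1) y'' assms(2,3) _ assms(4)] assms(4) by blast
    thus "A y'' t = (if y'' = y' then 1 else 0)" by (simp add: A_def)
  qed
  thus ?thesis using assms(2) by simp
qed

lemma U_0: "(\<And>y'. y' \<in> F y \<Longrightarrow> d y' t \<noteq> 1) \<Longrightarrow> U y t = 0"
  unfolding U_def A_def by (intro sum.neutral) auto

lemma U_01: "y \<in> V \<Longrightarrow> t \<in> V \<Longrightarrow> U y t = 0 \<or> U y t = 1"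
  using U_0 U_1 by blast

lemma fibre_cosines:
  assumes x: "x \<in> V" and y: "y \<in> V" "d x y = 2" and y': "y' \<in> F y" and t: "t \<in> N x"
  shows "q * (real r - 1) * u (d y' t) = real r * A y' t - U y t"
    and "w (d y' t) = w2 + (w1 - w2) * U y t"
proof -
  have V: "y' \<in> V" "t \<in> V" "d x t = 1" using y' t F_V by (auto simp: N_iff)
  have cx: "d y' x = 2" using fibre_dist_2[OF y(1) y' x] d_sym[OF x y(1)] y(2) by simp
  have "d y' t \<le> 3" using d_triangle[OF V(1) x V(2)] cx V(3) by simp
  moreover have "1 \<le> d y' t"
    using d_triangle[OF V(1,2) x] cx V(3) d_sym[OF V(2) x] by simp
  ultimately consider "d y' t = 1" | "d y' t = 2" | "d y' t = 3" by linarith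
  hence "q * (real r - 1) * u (d y' t) = real r * A y' t - U y t \<and> w (d y' t) = w2 + (w1 - w2) * U y t"
  proof cases
    case 1
    thus ?thesis using U_1[OF y(1) y' V(2) 1] q_gt_1 by (simp add: u_def w_def A_def)
  next
    case 2
    have "d y'' t = 2" if "y'' \<in> F y" for y''
      using fibre_dist_2[OF V(1) _ V(2) 2, of y''] F_eq[OF y(1) y'] that by simp
    hence "U y t = 0" by (intro U_0) simp
    thus ?thesis using 2 by (simp add: u_def w_def A_def)
  next
    case 3
    obtain y'' where y'': "y'' \<in> F y'" "d y'' t = 1" using fibre_neighbour_exists[OF V(1,2) 3] by blast
    hence "U y t = 1" using U_1[OF y(1) _ V(2)] F_eq[OF y(1) y'] by blast
    thus ?thesis using 3 q_gt_1 r_ge_2 by (simp add: u_def w_def A_def)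
  qed
  thus "q * (real r - 1) * u (d y' t) = real r * A y' t - U y t"
    and "w (d y' t) = w2 + (w1 - w2) * U y t" by auto
qed

lemma sum_common_neighbours:
  assumes x: "x \<in> V" and y: "y \<in> V" "d x y = 2" and y': "y' \<in> F y"
  shows "(\<Sum>t\<in>N x. A y' t) = c2"
proof -
  have cx: "y' \<in> V" "d y' x = 2" using fibre_dist_2[OF y(1) y' x] d_sym[OF x y(1)] y(2) y' F_V by auto
  have "(\<Sum>t\<in>N x. A y' t) = radial (\<lambda>i. if i = 1 then 1 else 0) 2"
    unfolding A_def using sum_N_radial[OF cx(1) x, of "\<lambda>i. if i = 1 then 1 else 0"] cx(2) by simp
  thus ?thesis unfolding radial_values by simp
qed

text \<open>Orthogonality for \<open>y'\<close> and \<open>s\<close> is used in both orders.  With \<open>u\<close> at \<open>y'\<close> and \<open>w\<close> at \<open>s\<close>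
  it makes \<open>r\<close> times the indicator of one \<open>\<mu>\<close>-graph minus that of the union a \<open>p\<close>-eigenvector of
  the local graph.  With \<open>w\<close> at \<open>y'\<close>
  and \<open>u\<close> at \<open>s\<close> it gives the number of neighbours of \<open>s\<close> in the union.\<close>

lemma mu_graph_equitable:
  assumes x: "x \<in> V" and y: "y \<in> V" "d x y = 2" and y': "y' \<in> F y" and s: "s \<in> N x"
  shows "(\<Sum>t\<in>N x. A s t * A y' t) = p * A y' s + (p + q) / real r * (1 - U y s)"
proof -
  have V: "y' \<in> V" "s \<in> V" "d s x = 1" using y' s F_V x d_sym by (auto simp: N_iff)
  have cx: "d y' x = 2" using fibre_dist_2[OF y(1) y' x] d_sym[OF x y(1)] y(2) by simp
  have nz: "q \<noteq> 0" "real r - 1 \<noteq> 0" "real r \<noteq> 0" "w1 - w2 \<noteq> 0" using q_gt_1 r_ge_2 w_gap(3) by auto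
  have "0 = (\<Sum>t\<in>N x. u (d y' t) * w (d s t))"
    using local_product[OF x V(1,2)] cx by (simp add: u_vals)
  also have "\<dots> = (\<Sum>t\<in>N x. u (d y' t) * (w2 + (w1 - w2) * (A s t - p * I s t)))"
    using w_local[OF x s] by simp
  also have "\<dots> = w2 * (\<Sum>t\<in>N x. u (d y' t)) +
      (w1 - w2) * ((\<Sum>t\<in>N x. A s t * u (d y' t)) - p * (\<Sum>t\<in>N x. I s t * u (d y' t)))"
    unfolding sum_distrib_left sum_subtractf[symmetric] sum.distrib[symmetric]
    by (intro sum.cong refl) (simp add: algebra_simps)
  also have "\<dots> = (w1 - w2) * ((\<Sum>t\<in>N x. A s t * u (d y' t)) - p * u (d y' s))"
    using sum_u[OF x V(1)] cx s by (simp add: u_vals)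
  finally have "(\<Sum>t\<in>N x. A s t * u (d y' t)) = p * u (d y' s)" using nz by simp
  hence "q * (real r - 1) * (\<Sum>t\<in>N x. A s t * u (d y' t)) = p * (q * (real r - 1) * u (d y' s))" by simp
  also have "q * (real r - 1) * (\<Sum>t\<in>N x. A s t * u (d y' t)) =
    (\<Sum>t\<in>N x. A s t * (q * (real r - 1) * u (d y' t)))"
    unfolding sum_distrib_left by (intro sum.cong refl) simp
  also have "\<dots> = (\<Sum>t\<in>N x. A s t * (real r * A y' t - U y t))"
    using fibre_cosines(1)[OF x y y'] by (intro sum.cong refl) simp
  also have "\<dots> = real r * (\<Sum>t\<in>N x. A s t * A y' t) - (\<Sum>t\<in>N x. A s t * U y t)"
    unfolding sum_distrib_left sum_subtractf[symmetric] by (intro sum.cong refl) (simp add: algebra_simps)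
  finally have 1: "real r * (\<Sum>t\<in>N x. A s t * A y' t) - (\<Sum>t\<in>N x. A s t * U y t) =
    p * (real r * A y' s - U y s)" using fibre_cosines(1)[OF x y y' s] by simp
  have u_sum: "(\<Sum>t\<in>N x. I s t + A s t / q) = \<theta> 1 * u 1"
    using sum_u[OF x V(2)] V(3) u_local[OF x s] by simp
  have "\<theta> 1 * w 1 * (u 1 * w 2) = (\<Sum>t\<in>N x. u (d s t) * w (d y' t))"
    using local_product[OF x V(2,1)] cx V(3) by simp
  also have "\<dots> = (\<Sum>t\<in>N x. (I s t + A s t / q) * (w2 + (w1 - w2) * U y t))"
    using u_local[OF x s] fibre_cosines(2)[OF x y y'] by (intro sum.cong refl) simp
  also have "\<dots> = w2 * (\<Sum>t\<in>N x. I s t + A s t / q) +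
      (w1 - w2) * ((\<Sum>t\<in>N x. I s t * U y t) + (\<Sum>t\<in>N x. A s t * U y t) / q)"
    unfolding sum_distrib_left sum_divide_distrib sum.distrib[symmetric]
    by (intro sum.cong refl) (simp add: algebra_simps add_divide_distrib diff_divide_distrib)
  also have "\<dots> = w2 * (\<theta> 1 / q) + (w1 - w2) * (U y s + (\<Sum>t\<in>N x. A s t * U y t) / q)"
    unfolding u_sum sum_I[OF finite_N s] unfolding u_vals by simp
  finally have "(w1 - w2) * (q * U y s + (\<Sum>t\<in>N x. A s t * U y t)) = w2 * (\<theta> 1 * w1) - w2 * \<theta> 1"
    using nz(1) unfolding u_vals w_vals by (simp add: field_simps)
  also have "\<dots> = (w1 - w2) * (p + q)"
    using w_gap(2) \<theta>1_pos by (simp add: w1_def algebra_simps)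
  finally have 2: "(\<Sum>t\<in>N x. A s t * U y t) = p + q - q * U y s"
    using mult_left_cancel[OF nz(4)] by force
  show ?thesis using 1 unfolding 2 using nz(3) by (simp add: field_simps)
qed

end

section \<open>Compressing a projection\<close>

text \<open>Here \<open>R\<close> is \<open>m\<close> times an orthogonal projection.  With \<open>P\<close> the restriction to \<open>W\<close>, the left-hand side is
  \<open>tr ((R P R - \<tau> R)\<^sup>2)\<close>, and \<open>R R = m R\<close> reduces it to traces of \<open>P R P\<close> and \<open>R\<close>.\<close>

lemma compressed_projection:
  fixes R :: "'a \<Rightarrow> 'a \<Rightarrow> real"
  assumes fin: "finite D" and W: "W \<subseteq> D"
    and sym: "\<And>s t. s \<in> D \<Longrightarrow> t \<in> D \<Longrightarrow> R s t = R t s"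
    and sq: "\<And>s t. s \<in> D \<Longrightarrow> t \<in> D \<Longrightarrow> (\<Sum>v\<in>D. R s v * R v t) = m * R s t"
  shows "(\<Sum>s\<in>D. \<Sum>t\<in>D. ((\<Sum>v\<in>W. R s v * R v t) - \<tau> * R s t)\<^sup>2) =
    m\<^sup>2 * (\<Sum>v\<in>W. \<Sum>v'\<in>W. (R v v')\<^sup>2) - 2 * \<tau> * m\<^sup>2 * (\<Sum>v\<in>W. R v v) + \<tau>\<^sup>2 * m * (\<Sum>s\<in>D. R s s)"
proof -
  have WD: "v \<in> D" if "v \<in> W" for v using W that by blast
  have sq': "(\<Sum>v\<in>D. R v s * R v t) = m * R s t" if "s \<in> D" "t \<in> D" for s t
    using sq[OF that] sym that by (metis (no_types, lifting) sum.cong)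
  have sq'': "(\<Sum>v\<in>D. R s v * R t v) = m * R s t" if "s \<in> D" "t \<in> D" for s t
    using sq[OF that] sym that by (metis (no_types, lifting) sum.cong)
  let ?P = "\<lambda>s t. \<Sum>v\<in>W. R s v * R v t"
  have 1: "(\<Sum>s\<in>D. \<Sum>t\<in>D. (?P s t)\<^sup>2) = m\<^sup>2 * (\<Sum>v\<in>W. \<Sum>v'\<in>W. (R v v')\<^sup>2)"
  proof -
    have "(\<Sum>s\<in>D. \<Sum>t\<in>D. (?P s t)\<^sup>2) =
        (\<Sum>v\<in>W. \<Sum>v'\<in>W. (\<Sum>s\<in>D. R s v * R s v') * (\<Sum>t\<in>D. R v t * R v' t))"
    proof -
      have "(\<Sum>s\<in>D. \<Sum>t\<in>D. (?P s t)\<^sup>2) =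
        (\<Sum>s\<in>D. \<Sum>t\<in>D. \<Sum>v\<in>W. \<Sum>v'\<in>W. (R s v * R s v') * (R v t * R v' t))"
        unfolding power2_eq_square sum_product by (intro sum.cong refl) simp
      also have "\<dots> = (\<Sum>s\<in>D. \<Sum>v\<in>W. \<Sum>t\<in>D. \<Sum>v'\<in>W. (R s v * R s v') * (R v t * R v' t))"
        by (intro sum.cong refl sum.swap)
      also have "\<dots> = (\<Sum>v\<in>W. \<Sum>s\<in>D. \<Sum>t\<in>D. \<Sum>v'\<in>W. (R s v * R s v') * (R v t * R v' t))"
        by (rule sum.swap)
      also have "\<dots> = (\<Sum>v\<in>W. \<Sum>s\<in>D. \<Sum>v'\<in>W. \<Sum>t\<in>D. (R s v * R s v') * (R v t * R v' t))"
        by (intro sum.cong refl sum.swap)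
      also have "\<dots> = (\<Sum>v\<in>W. \<Sum>v'\<in>W. \<Sum>s\<in>D. \<Sum>t\<in>D. (R s v * R s v') * (R v t * R v' t))"
        by (intro sum.cong refl sum.swap)
      finally show ?thesis by (simp add: sum_product)
    qed
    also have "\<dots> = (\<Sum>v\<in>W. \<Sum>v'\<in>W. m\<^sup>2 * (R v v')\<^sup>2)"
      using sq' sq'' WD by (intro sum.cong refl) (simp add: power2_eq_square)
    finally show ?thesis by (simp add: sum_distrib_left)
  qed
  have 2: "(\<Sum>s\<in>D. \<Sum>t\<in>D. ?P s t * R s t) = m\<^sup>2 * (\<Sum>v\<in>W. R v v)"
  proof -
    have "(\<Sum>s\<in>D. \<Sum>t\<in>D. ?P s t * R s t) = (\<Sum>s\<in>D. \<Sum>t\<in>D. \<Sum>v\<in>W. R s v * (R v t * R s t))"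
      by (simp add: sum_distrib_right mult.assoc)
    also have "\<dots> = (\<Sum>s\<in>D. \<Sum>v\<in>W. \<Sum>t\<in>D. R s v * (R v t * R s t))"
      by (intro sum.cong refl sum.swap)
    also have "\<dots> = (\<Sum>v\<in>W. \<Sum>s\<in>D. \<Sum>t\<in>D. R s v * (R v t * R s t))" by (rule sum.swap)
    also have "\<dots> = (\<Sum>v\<in>W. \<Sum>s\<in>D. m * (R s v * R v s))"
      using sq'' WD by (intro sum.cong refl) (simp flip: sum_distrib_left)
    also have "\<dots> = (\<Sum>v\<in>W. m\<^sup>2 * R v v)"
    proof (intro sum.cong refl)
      fix v assume "v \<in> W"
      hence "(\<Sum>s\<in>D. R s v * R v s) = m * R v v"
        using sq[of v v] WD by (simp add: mult.commute)
      thus "(\<Sum>s\<in>D. m * (R s v * R v s)) = m\<^sup>2 * R v v"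
        by (simp add: power2_eq_square flip: sum_distrib_left)
    qed
    finally show ?thesis by (simp add: sum_distrib_left)
  qed
  have 3: "(\<Sum>s\<in>D. \<Sum>t\<in>D. (R s t)\<^sup>2) = m * (\<Sum>s\<in>D. R s s)"
    using sq'' by (simp add: power2_eq_square sum_distrib_left)
  have "(\<Sum>s\<in>D. \<Sum>t\<in>D. (?P s t - \<tau> * R s t)\<^sup>2) =
    (\<Sum>s\<in>D. \<Sum>t\<in>D. (?P s t)\<^sup>2) - 2 * \<tau> * (\<Sum>s\<in>D. \<Sum>t\<in>D. ?P s t * R s t)
      + \<tau>\<^sup>2 * (\<Sum>s\<in>D. \<Sum>t\<in>D. (R s t)\<^sup>2)"
    unfolding power2_diff sum.distrib sum_subtractf
    by (simp add: sum_distrib_left power_mult_distrib mult_ac)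
  thus ?thesis unfolding 1 2 3 by (simp add: algebra_simps)
qed

section \<open>Disjoint regular subgraphs of a strongly regular graph\<close>

text \<open>\<open>D\<close> stands for the vertices of a local graph, \<open>C\<close> for an antipodal class at distance \<open>2\<close> from its
  centre, and \<open>e c\<close> for the characteristic function of the \<open>\<mu>\<close>-graph belonging to \<open>c\<close>.\<close>

locale split_local_graph =
  fixes D :: "'a set" and C :: "'c set" and A :: "'a \<Rightarrow> 'a \<Rightarrow> real" and e :: "'c \<Rightarrow> 'a \<Rightarrow> real"
    and p q n :: real
  assumes fin: "finite D" "finite C" and C: "C \<noteq> {}"
    and q: "q > 1" and p: "p \<ge> 0"
    and A_sym: "s \<in> D \<Longrightarrow> t \<in> D \<Longrightarrow> A s t = A t s"
    and A_01: "A s t = 0 \<or> A s t = 1" and A_irrefl: "s \<in> D \<Longrightarrow> A s s = 0"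
    and e_01: "e c s = 0 \<or> e c s = 1"
    and e_orth: "c \<in> C \<Longrightarrow> c' \<in> C \<Longrightarrow> (\<Sum>s\<in>D. e c s * e c' s) = (if c = c' then n else 0)"
    and U_01: "s \<in> D \<Longrightarrow> (\<Sum>c\<in>C. e c s) = 0 \<or> (\<Sum>c\<in>C. e c s) = 1"
    and valency: "s \<in> D \<Longrightarrow> (\<Sum>t\<in>D. A s t) = p * (q + 1)"
    and card_D: "real (card D) = q * (p * q + p + q)"
    and srg: "s \<in> D \<Longrightarrow> t \<in> D \<Longrightarrow>
      (\<Sum>v\<in>D. A s v * A v t) = (p - q) * A s t + p * q * (if s = t then 1 else 0) + p"
    and equitable: "c \<in> C \<Longrightarrow> s \<in> D \<Longrightarrow>
      (\<Sum>t\<in>D. A s t * e c t) = p * e c s + (p + q) / real (card C) * (1 - (\<Sum>c\<in>C. e c s))"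
    and separated: "c \<in> C \<Longrightarrow> c' \<in> C \<Longrightarrow> s \<in> D \<Longrightarrow> t \<in> D \<Longrightarrow> e c s = 1 \<Longrightarrow> e c' t = 1 \<Longrightarrow>
      c \<noteq> c' \<Longrightarrow> A s t = 0"
    and size: "real (card C) * n = q * (p + q)"
begin

text \<open>\<open>H / q\<close> is obtained from \<open>G = A + q I\<close> by averaging over the blocks of the partition of \<open>D\<close> into
  the supports of the \<open>e c\<close> and the rest.  Hence \<open>R\<close> acts as \<open>G\<close> on the vectors orthogonal to the
  parts and vanishes on the span of the parts; on the former, \<open>G\<close> is \<open>p + q\<close> on the
  \<open>p\<close>-eigenvectors and \<open>0\<close> on the \<open>- q\<close>-eigenvectors of \<open>A\<close>.\<close>

definition r :: real where "r = real (card C)"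
definition U :: "'a \<Rightarrow> real" where "U s = (\<Sum>c\<in>C. e c s)"
definition K :: "'a \<Rightarrow> 'a \<Rightarrow> real" where "K s t = (\<Sum>c\<in>C. e c s * e c t)"
definition I :: "'a \<Rightarrow> 'a \<Rightarrow> real" where "I s t = (if s = t then 1 else 0)"
definition G :: "'a \<Rightarrow> 'a \<Rightarrow> real" where "G s t = A s t + q * I s t"
definition H :: "'a \<Rightarrow> 'a \<Rightarrow> real" where "H s t = 1 - U s * U t + r * K s t"
definition R :: "'a \<Rightarrow> 'a \<Rightarrow> real" where "R s t = G s t - H s t / q"

lemma r_pos: "r > 0"
  using fin C by (simp add: r_def card_gt_0_iff)

lemma sum_I: "s \<in> D \<Longrightarrow> (\<Sum>t\<in>D. I s t * f t) = f s" "s \<in> D \<Longrightarrow> (\<Sum>t\<in>D. f t * I t s) = f s"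
  using fin by (simp_all add: I_def if_distrib[of "\<lambda>x. x * _"] if_distrib[of "\<lambda>x. _ * x"] sum.delta sum.delta' cong: if_cong)

lemma U_sq: "s \<in> D \<Longrightarrow> U s * U s = U s"
  using U_01[of s] by (auto simp: U_def)

lemma K_sym: "K s t = K t s"
  by (simp add: K_def mult.commute)

lemma sum_e: "c \<in> C \<Longrightarrow> (\<Sum>s\<in>D. e c s) = n"
proof -
  assume c: "c \<in> C"
  have "(\<Sum>s\<in>D. e c s) = (\<Sum>s\<in>D. e c s * e c s)"
    using e_01[of c] by (intro sum.cong refl) (metis mult_zero_left mult_1)
  thus ?thesis using e_orth[OF c c] by simp
qed

lemma sum_U: "(\<Sum>s\<in>D. U s) = r * n"
  unfolding U_def by (subst sum.swap) (simp add: sum_e r_def)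

lemma sum_Ue: "c \<in> C \<Longrightarrow> (\<Sum>s\<in>D. U s * e c s) = n"
  unfolding U_def sum_distrib_right by (subst sum.swap) (use fin e_orth in simp)

lemma sum_K: "(\<Sum>v\<in>D. K s v) = n * U s"
proof -
  have "(\<Sum>v\<in>D. K s v) = (\<Sum>c\<in>C. e c s * (\<Sum>v\<in>D. e c v))"
    unfolding K_def sum_distrib_left by (rule sum.swap)
  also have "\<dots> = (\<Sum>c\<in>C. e c s * n)" using sum_e by simp
  finally show ?thesis by (simp add: U_def sum_distrib_left mult.commute)
qed

lemma sum_UK: "(\<Sum>v\<in>D. U v * K v t) = n * U t"
proof -
  have "(\<Sum>v\<in>D. U v * K v t) = (\<Sum>c\<in>C. (\<Sum>v\<in>D. U v * e c v) * e c t)"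
    unfolding K_def sum_distrib_left sum_distrib_right mult.assoc by (rule sum.swap)
  also have "\<dots> = (\<Sum>c\<in>C. n * e c t)" using sum_Ue by simp
  finally show ?thesis by (simp add: U_def sum_distrib_left)
qed

lemma sum_KK: "(\<Sum>v\<in>D. K s v * K v t) = n * K s t"
proof -
  have "(\<Sum>v\<in>D. K s v * K v t) = (\<Sum>v\<in>D. \<Sum>c\<in>C. \<Sum>c'\<in>C. e c s * e c' t * (e c v * e c' v))"
    unfolding K_def sum_product by (intro sum.cong refl) simp
  also have "\<dots> = (\<Sum>c\<in>C. \<Sum>v\<in>D. \<Sum>c'\<in>C. e c s * e c' t * (e c v * e c' v))" by (rule sum.swap)
  also have "\<dots> = (\<Sum>c\<in>C. \<Sum>c'\<in>C. \<Sum>v\<in>D. e c s * e c' t * (e c v * e c' v))"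
    by (intro sum.cong refl sum.swap)
  also have "\<dots> = (\<Sum>c\<in>C. \<Sum>c'\<in>C. e c s * e c' t * (if c = c' then n else 0))"
    using e_orth by (intro sum.cong refl) (simp flip: sum_distrib_left)
  also have "\<dots> = (\<Sum>c\<in>C. e c s * e c t * n)"
    using fin by (intro sum.cong refl) (simp add: if_distrib[of "\<lambda>x. _ * x"] sum.delta cong: if_cong)
  finally show ?thesis by (simp add: K_def sum_distrib_left mult_ac)
qed

lemma HH:
  assumes "s \<in> D" "t \<in> D"
  shows "(\<Sum>v\<in>D. H s v * H v t) = p * q\<^sup>2 + q * (p + q) * H s t"
proof -
  have UU: "(\<Sum>v\<in>D. U v * U v) = r * n" unfolding sum_U[symmetric] by (intro sum.cong refl U_sq)
  have KU: "(\<Sum>v\<in>D. K s v * U v) = n * U s" using sum_UK[of s] by (simp add: mult.commute K_sym[of s])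
  have K1: "(\<Sum>v\<in>D. K v t) = n * U t" using sum_K[of t] by (simp add: K_sym)
  have "(\<Sum>v\<in>D. H s v * H v t) = (\<Sum>v\<in>D. 1) - U t * (\<Sum>v\<in>D. U v) + r * (\<Sum>v\<in>D. K v t)
     - U s * (\<Sum>v\<in>D. U v) + U s * U t * (\<Sum>v\<in>D. U v * U v) - r * U s * (\<Sum>v\<in>D. U v * K v t)
     + r * (\<Sum>v\<in>D. K s v) - r * U t * (\<Sum>v\<in>D. K s v * U v) + r\<^sup>2 * (\<Sum>v\<in>D. K s v * K v t)"
    unfolding sum_distrib_left sum_subtractf[symmetric] sum.distrib[symmetric] H_def
    by (intro sum.cong refl) (simp add: algebra_simps power2_eq_square)
  also have "\<dots> = real (card D) - r * n * (U s * U t) + r\<^sup>2 * n * K s t"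
    unfolding sum_U UU KU K1 sum_UK sum_K sum_KK by (simp add: algebra_simps power2_eq_square)
  also have "\<dots> = (real (card D) - r * n) + r * n * H s t"
    by (simp add: H_def algebra_simps power2_eq_square)
  finally show ?thesis unfolding card_D size[folded r_def] by (simp add: algebra_simps power2_eq_square)
qed

lemma sum_G: "s \<in> D \<Longrightarrow> (\<Sum>t\<in>D. G s t) = p * q + p + q"
  using sum_I(1)[of s "\<lambda>_. 1"] valency[of s]
  by (simp add: G_def sum.distrib algebra_simps flip: sum_distrib_left)

lemma sum_Ge: "c \<in> C \<Longrightarrow> s \<in> D \<Longrightarrow> (\<Sum>t\<in>D. G s t * e c t) = (p + q) * e c s + (p + q) / r * (1 - U s)"
proof -
  assume *: "c \<in> C" "s \<in> D"
  have "(\<Sum>t\<in>D. G s t * e c t) = (\<Sum>t\<in>D. A s t * e c t) + q * (\<Sum>t\<in>D. I s t * e c t)"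
    unfolding sum_distrib_left sum.distrib[symmetric] G_def by (intro sum.cong refl) (simp add: algebra_simps)
  thus ?thesis unfolding equitable[OF *] sum_I[OF *(2)] by (simp add: r_def U_def algebra_simps)
qed

lemma sum_GU: "s \<in> D \<Longrightarrow> (\<Sum>t\<in>D. G s t * U t) = p + q"
proof -
  assume s: "s \<in> D"
  have "(\<Sum>t\<in>D. G s t * U t) = (\<Sum>c\<in>C. \<Sum>t\<in>D. G s t * e c t)"
    unfolding U_def sum_distrib_left by (rule sum.swap)
  also have "\<dots> = (\<Sum>c\<in>C. (p + q) * e c s + (p + q) / r * (1 - U s))" using sum_Ge s by simp
  also have "\<dots> = (p + q) * U s + r * ((p + q) / r * (1 - U s))"
    by (simp add: sum.distrib U_def r_def sum_distrib_left)
  also have "r * ((p + q) / r * (1 - U s)) = (p + q) * (1 - U s)" using r_pos by simp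
  finally show ?thesis by (simp add: algebra_simps)
qed

lemma sum_GK: "s \<in> D \<Longrightarrow> r * (\<Sum>v\<in>D. G s v * K v t) = r * (p + q) * K s t + (p + q) * (1 - U s) * U t"
proof -
  assume s: "s \<in> D"
  have "(\<Sum>v\<in>D. G s v * K v t) = (\<Sum>c\<in>C. (\<Sum>v\<in>D. G s v * e c v) * e c t)"
    unfolding K_def sum_distrib_left sum_distrib_right mult.assoc by (rule sum.swap)
  also have "\<dots> = (\<Sum>c\<in>C. ((p + q) * e c s + (p + q) / r * (1 - U s)) * e c t)" using sum_Ge s by simp
  also have "\<dots> = (p + q) * K s t + (p + q) / r * (1 - U s) * U t"
    unfolding K_def U_def[of t] sum_distrib_left sum.distrib[symmetric]
    by (intro sum.cong refl) (simp add: algebra_simps)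
  finally have "r * (\<Sum>v\<in>D. G s v * K v t) = r * (p + q) * K s t + r * ((p + q) / r) * (1 - U s) * U t"
    by (simp add: algebra_simps)
  thus ?thesis using r_pos by simp
qed

lemma GH:
  assumes "s \<in> D" "t \<in> D"
  shows "(\<Sum>v\<in>D. G s v * H v t) = p * q + (p + q) * H s t"
proof -
  have "(\<Sum>v\<in>D. G s v * H v t) = (\<Sum>v\<in>D. G s v) - U t * (\<Sum>v\<in>D. G s v * U v) + r * (\<Sum>v\<in>D. G s v * K v t)"
    unfolding sum_distrib_left sum_subtractf[symmetric] sum.distrib[symmetric] H_def
    by (intro sum.cong refl) (simp add: algebra_simps)
  thus ?thesis unfolding sum_G[OF assms(1)] sum_GU[OF assms(1)] sum_GK[OF assms(1)]
    by (simp add: H_def algebra_simps)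
qed

lemma H_sym: "H s t = H t s"
  by (simp add: H_def K_sym mult.commute)

lemma G_sym: "s \<in> D \<Longrightarrow> t \<in> D \<Longrightarrow> G s t = G t s"
  by (simp add: G_def I_def A_sym)

lemma R_sym: "s \<in> D \<Longrightarrow> t \<in> D \<Longrightarrow> R s t = R t s"
  by (simp add: R_def G_sym H_sym)

lemma HG:
  assumes "s \<in> D" "t \<in> D"
  shows "(\<Sum>v\<in>D. H s v * G v t) = p * q + (p + q) * H s t"
proof -
  have "(\<Sum>v\<in>D. H s v * G v t) = (\<Sum>v\<in>D. G t v * H v s)"
    using assms G_sym H_sym by (intro sum.cong refl) (simp add: mult.commute)
  thus ?thesis using GH[OF assms(2,1)] H_sym by simp
qed

lemma GG:
  assumes "s \<in> D" "t \<in> D"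
  shows "(\<Sum>v\<in>D. G s v * G v t) = (p + q) * G s t + p"
proof -
  have "(\<Sum>v\<in>D. G s v * G v t) = (\<Sum>v\<in>D. A s v * A v t) + q * (\<Sum>v\<in>D. A s v * I v t)
     + q * (\<Sum>v\<in>D. I s v * A v t) + q\<^sup>2 * (\<Sum>v\<in>D. I s v * I v t)"
    unfolding sum_distrib_left sum.distrib[symmetric] G_def
    by (intro sum.cong refl) (simp add: algebra_simps power2_eq_square)
  thus ?thesis unfolding srg[OF assms] sum_I[OF assms(1)] sum_I[OF assms(2)]
    by (simp add: G_def I_def algebra_simps power2_eq_square)
qed

lemma R_square:
  assumes "s \<in> D" "t \<in> D"
  shows "(\<Sum>v\<in>D. R s v * R v t) = (p + q) * R s t"
proof -
  have "(\<Sum>v\<in>D. R s v * R v t) = (\<Sum>v\<in>D. G s v * G v t) - (\<Sum>v\<in>D. G s v * H v t) / q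
     - (\<Sum>v\<in>D. H s v * G v t) / q + (\<Sum>v\<in>D. H s v * H v t) / q\<^sup>2"
    unfolding sum_divide_distrib sum_subtractf[symmetric] sum.distrib[symmetric] R_def
    by (intro sum.cong refl) (simp add: algebra_simps power2_eq_square)
  also have "\<dots> = (p + q) * R s t"
    unfolding GG[OF assms] GH[OF assms] HG[OF assms] HH[OF assms] R_def
    using q by (simp add: field_simps power2_eq_square)
  finally show ?thesis .
qed

definition W :: "'a set" where "W = {s \<in> D. U s = 1}"

lemma W_D: "W \<subseteq> D" and finite_W: "finite W"
  using fin by (auto simp: W_def)

lemma sum_W: "(\<Sum>s\<in>W. f s) = (\<Sum>s\<in>D. U s * f s)"
proof -
  have "(\<Sum>s\<in>D. U s * f s) = (\<Sum>s\<in>D. if U s = 1 then f s else 0)"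
    using U_01 by (intro sum.cong refl) (auto simp: U_def)
  thus ?thesis unfolding W_def using fin by (simp add: sum.inter_filter)
qed

lemma card_W: "real (card W) = r * n"
  using sum_W[of "\<lambda>_. 1"] sum_U by simp

lemma class_of_W:
  assumes "s \<in> W"
  shows "\<exists>c\<in>C. e c s = 1"
proof -
  have "(\<Sum>c\<in>C. e c s) \<noteq> 0" using assms by (simp add: W_def U_def)
  then obtain c where "c \<in> C" "e c s \<noteq> 0" by (meson sum.neutral)
  thus ?thesis using e_01[of c s] by blast
qed

lemma class_unique:
  assumes s: "s \<in> D" and c: "c \<in> C" "e c s = 1" and c': "c' \<in> C" "e c' s = 1"
  shows "c = c'"
proof (rule ccontr)
  assume "c \<noteq> c'"
  hence "(\<Sum>s\<in>D. e c s * e c' s) = 0" using e_orth c c' by simp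
  moreover have "0 \<le> e c t * e c' t" for t using e_01[of c t] e_01[of c' t] by auto
  ultimately have "e c s * e c' s = 0" using s fin by (simp add: sum_nonneg_eq_0_iff)
  thus False using c c' by simp
qed

lemma K_class:
  assumes s: "s \<in> D" and c: "c \<in> C" "e c s = 1"
  shows "K s t = e c t"
proof -
  have "K s t = (\<Sum>c'\<in>C. if c' = c then e c t else 0)"
    unfolding K_def using class_unique[OF s c] c e_01 by (intro sum.cong refl) (metis mult_1 mult_zero_left)
  thus ?thesis using fin c by simp
qed

lemma R_W:
  assumes "s \<in> W" "t \<in> W"
  shows "R s t = A s t + q * I s t - r / q * K s t"
  using assms by (simp add: R_def G_def H_def W_def)

lemma U_class:
  assumes "s \<in> D" "c \<in> C" "e c s = 1"
  shows "U s = 1"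
proof -
  have "0 < (\<Sum>c\<in>C. e c s)"
    using assms(2,3) fin e_01 by (intro sum_pos2[of C c]) (auto, metis order_refl zero_le_one)
  thus ?thesis using U_01[OF assms(1)] by (simp add: U_def)
qed

lemma trace_W: "(\<Sum>s\<in>W. R s s) = (p + q) * (q\<^sup>2 - r)"
proof -
  have "R s s = q - r / q" if s: "s \<in> W" for s
  proof -
    obtain c where "c \<in> C" "e c s = 1" using class_of_W s by blast
    hence "K s s = 1" using K_class that W_D by auto
    thus ?thesis using R_W[OF that that] that A_irrefl W_D by (auto simp: I_def)
  qed
  hence "(\<Sum>s\<in>W. R s s) = r * n * (q - r / q)" using card_W by simp
  also have "\<dots> = q * (p + q) * (q - r / q)" using size by (simp add: r_def)
  also have "\<dots> = (p + q) * (q\<^sup>2 - r)" using q by (simp add: field_simps power2_eq_square)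
  finally show ?thesis .
qed

lemma trace_D: "(\<Sum>s\<in>D. R s s) = p * q * (q\<^sup>2 - 1) + (p + q) * (q\<^sup>2 - r)"
proof -
  have out: "R s s = q - 1 / q" if "s \<in> D - W" for s
  proof -
    have U: "U s = 0" using that U_01[of s] by (auto simp: W_def U_def)
    have "e c s = 0" if "c \<in> C" for c
      using U_class[of s c] U e_01[of c s] that \<open>s \<in> D - W\<close> by auto
    hence "K s s = 0" by (simp add: K_def)
    thus ?thesis using U that A_irrefl by (simp add: R_def G_def H_def I_def)
  qed
  have "(\<Sum>s\<in>D. R s s) = (\<Sum>s\<in>D - W. R s s) + (\<Sum>s\<in>W. R s s)"
    by (rule sum.subset_diff[OF W_D]) (use fin in simp)
  also have "(\<Sum>s\<in>D - W. R s s) = (real (card D) - r * n) * (q - 1 / q)"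
    using out card_W by (simp add: card_Diff_subset[OF finite_W W_D] of_nat_diff card_mono[OF fin(1) W_D])
  also have "\<dots> = p * q * (q\<^sup>2 - 1)"
    using size q unfolding card_D r_def[symmetric] by (simp add: field_simps power2_eq_square)
  finally show ?thesis using trace_W by simp
qed

lemma sum_A_W: "s \<in> W \<Longrightarrow> (\<Sum>t\<in>W. A s t) = p"
proof -
  assume s: "s \<in> W"
  have sD: "s \<in> D" and Us: "U s = 1" using s by (auto simp: W_def)
  have "p + q = (\<Sum>t\<in>D. A s t * U t) + q * (\<Sum>t\<in>D. I s t * U t)"
    unfolding sum_GU[OF sD, symmetric] sum_distrib_left sum.distrib[symmetric] G_def
    by (intro sum.cong refl) (simp add: algebra_simps)
  thus ?thesis unfolding sum_W sum_I[OF sD] using Us by (simp add: mult.commute)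
qed

lemma trace_W_square: "(\<Sum>s\<in>W. \<Sum>t\<in>W. (R s t)\<^sup>2) = (p + q) * (q * (p + q\<^sup>2) - r * (p + q))"
proof -
  have "(R s t)\<^sup>2 = (1 - 2 * r / q) * A s t + (q\<^sup>2 - 2 * r) * I s t + (r / q)\<^sup>2 * K s t"
    if st: "s \<in> W" "t \<in> W" for s t
  proof -
    have D: "s \<in> D" "t \<in> D" using st W_D by auto
    obtain c where c: "c \<in> C" "e c s = 1" using class_of_W st by blast
    obtain c' where c': "c' \<in> C" "e c' t = 1" using class_of_W st by blast
    have K: "K s t = e c t" using K_class[OF D(1) c] .
    consider "s = t" | "s \<noteq> t" "A s t = 1" "K s t = 1" | "s \<noteq> t" "A s t = 0" "K s t = 0 \<or> K s t = 1"
      using A_01[of s t] e_01[of c t] separated[OF c(1) c'(1) D c(2) c'(2)] c' K by fastforce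
    thus ?thesis unfolding R_W[OF st]
    proof cases
      case 1
      hence "K s t = 1" "A s t = 0" "I s t = 1" using K c A_irrefl D by (auto simp: I_def)
      thus "(A s t + q * I s t - r / q * K s t)\<^sup>2 =
          (1 - 2 * r / q) * A s t + (q\<^sup>2 - 2 * r) * I s t + (r / q)\<^sup>2 * K s t"
        using q by (simp add: power2_diff)
    qed (auto simp: I_def power2_diff)
  qed
  hence "(\<Sum>s\<in>W. \<Sum>t\<in>W. (R s t)\<^sup>2) =
    (\<Sum>s\<in>W. \<Sum>t\<in>W. (1 - 2 * r / q) * A s t + (q\<^sup>2 - 2 * r) * I s t + (r / q)\<^sup>2 * K s t)"
    by (intro sum.cong refl) simp
  also have "\<dots> = (\<Sum>s\<in>W. (1 - 2 * r / q) * p + (q\<^sup>2 - 2 * r) * 1 + (r / q)\<^sup>2 * n)"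
  proof (intro sum.cong refl)
    fix s assume s: "s \<in> W"
    have sI: "(\<Sum>t\<in>W. I s t) = 1" using s finite_W by (simp add: I_def)
    have sK: "(\<Sum>t\<in>W. K s t) = n"
      unfolding sum_W using sum_UK[of s] s by (simp add: K_sym W_def)
    show "(\<Sum>t\<in>W. (1 - 2 * r / q) * A s t + (q\<^sup>2 - 2 * r) * I s t + (r / q)\<^sup>2 * K s t) =
      (1 - 2 * r / q) * p + (q\<^sup>2 - 2 * r) * 1 + (r / q)\<^sup>2 * n"
      unfolding sum.distrib sum_distrib_left[symmetric] sum_A_W[OF s] sI sK ..
  qed
  also have "\<dots> = r * n * ((1 - 2 * r / q) * p + (q\<^sup>2 - 2 * r)) + r * n * ((r / q)\<^sup>2 * n)"
    using card_W by (simp add: algebra_simps)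
  also have "r * n * ((r / q)\<^sup>2 * n) = (r * n) * (r * n) * r / q\<^sup>2"
    by (simp add: power2_eq_square)
  also have "r * n = q * (p + q)" using size by (simp add: r_def)
  also have "q * (p + q) * ((1 - 2 * r / q) * p + (q\<^sup>2 - 2 * r)) + q * (p + q) * (q * (p + q)) * r / q\<^sup>2
     = (p + q) * (q * (p + q\<^sup>2) - r * (p + q))"
    using q by (simp add: field_simps power2_eq_square)
  finally show ?thesis .
qed

text \<open>On the orthogonal complement of the parts, an eigenvalue \<open>\<eta>\<close> of one of the subgraphs gives the
  eigenvalue \<open>\<eta> + q\<close> of \<open>R\<close> compressed to \<open>W\<close>.  The number \<open>(p + q) / (q + 1)\<close> is the value of
  \<open>\<eta> + q\<close> at \<open>\<eta> = (p - q\<^sup>2) / (q + 1)\<close>, which is the only nontrivial eigenvalue besides \<open>- q\<close> in a strongly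
  regular graph with the extremal parameters.\<close>

lemma compression_defect:
  "(\<Sum>s\<in>D. \<Sum>t\<in>D. ((\<Sum>v\<in>W. R s v * R v t) - (p + q) / (q + 1) * R s t)\<^sup>2) =
    (p + q) ^ 3 * q\<^sup>2 / (q + 1)\<^sup>2 * (p + q ^ 3 - r * (p + q))"
proof -
  have q1: "q + 1 \<noteq> 0" using q by simp
  define m where "m = p + q"
  define z where "z = 1 / (q + 1)"
  have z: "z * (q + 1) = 1" using q1 by (simp add: z_def)
  have "(\<Sum>s\<in>D. \<Sum>t\<in>D. ((\<Sum>v\<in>W. R s v * R v t) - (m * z) * R s t)\<^sup>2) =
    m\<^sup>2 * (m * (q * (p + q\<^sup>2) - r * m)) - 2 * (m * z) * m\<^sup>2 * (m * (q\<^sup>2 - r))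
      + (m * z)\<^sup>2 * m * (p * q * (q\<^sup>2 - 1) + m * (q\<^sup>2 - r))"
    using compressed_projection[OF fin(1) W_D R_sym R_square, of "m * z"]
    unfolding trace_W trace_D trace_W_square m_def by simp
  also have "\<dots> = m ^ 3 * (q\<^sup>2 * (p + q ^ 3 - r * m)) * z\<^sup>2"
    using z m_def by algebra
  finally show ?thesis unfolding m_def z_def by (simp add: power_divide)
qed

lemma r_bound: "r * (p + q) \<le> p + q ^ 3"
proof -
  have "0 \<le> (p + q) ^ 3 * q\<^sup>2 / (q + 1)\<^sup>2 * (p + q ^ 3 - r * (p + q))"
    unfolding compression_defect[symmetric] by (intro sum_nonneg) simp
  moreover have "(p + q) ^ 3 * q\<^sup>2 / (q + 1)\<^sup>2 > 0" using p q by simp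
  ultimately have "0 \<le> p + q ^ 3 - r * (p + q)" by (simp only: zero_le_mult_iff) linarith
  thus ?thesis by simp
qed

text \<open>In the extremal case every term of the sum in \<open>compression_defect\<close> vanishes.  For \<open>s\<close> and \<open>t\<close> in
  the same subgraph, the sum over \<open>W\<close> in such a term only involves that subgraph and contains the number
  of common neighbours of \<open>s\<close> and \<open>t\<close> in it.\<close>

lemma common_neighbours_at_equality:
  assumes eq: "r * (p + q) = p + q ^ 3" and c: "c \<in> C" and s: "s \<in> D" "e c s = 1" and t: "t \<in> D" "e c t = 1"
  shows "(\<Sum>v\<in>D. e c v * (A s v * A v t)) =
    (p + q) / (q + 1) * (A s t + q * I s t - r / q) - 2 * q * A s t - q\<^sup>2 * I s t + r * (p + q) / q"
proof -
  let ?\<tau> = "(p + q) / (q + 1)"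
  have W: "s \<in> W" "t \<in> W" using U_class c s t by (auto simp: W_def)
  have "\<forall>s\<in>D. (\<Sum>t\<in>D. ((\<Sum>v\<in>W. R s v * R v t) - ?\<tau> * R s t)\<^sup>2) = 0"
    using compression_defect eq fin by (subst sum_nonneg_eq_0_iff[symmetric]) (auto intro: sum_nonneg)
  hence "(\<Sum>t\<in>D. ((\<Sum>v\<in>W. R s v * R v t) - ?\<tau> * R s t)\<^sup>2) = 0" using s by blast
  hence "((\<Sum>v\<in>W. R s v * R v t) - ?\<tau> * R s t)\<^sup>2 = 0"
    using fin t by (subst (asm) sum_nonneg_eq_0_iff) auto
  hence RR: "(\<Sum>v\<in>W. R s v * R v t) = ?\<tau> * R s t" by simp
  have Kt: "K v t = e c v" for v using K_class[OF t(1) c t(2), of v] K_sym by simp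
  have A_in: "A s v = A s v * e c v" "A v t = A v t * e c v" if "v \<in> W" for v
  proof -
    obtain c' where c': "c' \<in> C" "e c' v = 1" using class_of_W \<open>v \<in> W\<close> by blast
    have vD: "v \<in> D" using that W_D by blast
    have "c = c' \<or> A s v = 0 \<and> A v t = 0"
      using separated[OF c c'(1) s(1) vD s(2) c'(2)] separated[OF c'(1) c vD t(1) c'(2) t(2)] by blast
    thus "A s v = A s v * e c v" "A v t = A v t * e c v" using c' by auto
  qed
  have "(\<Sum>v\<in>W. R s v * R v t) =
    (\<Sum>v\<in>W. e c v * (A s v * A v t) + q * (A s v * I v t) + q * (I s v * A v t) + q\<^sup>2 * (I s v * I v t)
      - r / q * (A s v + A v t + q * (I s v * e c v) + q * (e c v * I v t)) + (r / q)\<^sup>2 * e c v)"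
  proof (intro sum.cong refl)
    fix v assume v: "v \<in> W"
    have e2: "e c v * e c v = e c v" using e_01[of c v] by auto
    have AA: "e c v * (A s v * A v t) = A s v * A v t" using A_in[OF v] by (metis mult.assoc mult.commute)
    have Rv: "R s v = A s v + q * I s v - r / q * e c v" "R v t = A v t + q * I v t - r / q * e c v"
      using R_W v W K_class[OF s(1) c s(2), of v] Kt[of v] by auto
    have expand: "(a + q * i - z * g) * (b + q * j - z * g) = a * b + q * (a * j) + q * (i * b) + q\<^sup>2 * (i * j)
      - z * (a * g + b * g + q * (i * g) + q * (g * j)) + z\<^sup>2 * (g * g)" for a b i j g z
      by (simp add: algebra_simps power2_eq_square)
    have "R s v * R v t = A s v * A v t + q * (A s v * I v t) + q * (I s v * A v t) + q\<^sup>2 * (I s v * I v t)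
      - r / q * (A s v * e c v + A v t * e c v + q * (I s v * e c v) + q * (e c v * I v t))
      + (r / q)\<^sup>2 * (e c v * e c v)"
      unfolding Rv by (rule expand)
    thus "R s v * R v t = e c v * (A s v * A v t) + q * (A s v * I v t) + q * (I s v * A v t) + q\<^sup>2 * (I s v * I v t)
      - r / q * (A s v + A v t + q * (I s v * e c v) + q * (e c v * I v t)) + (r / q)\<^sup>2 * e c v"
      unfolding e2 AA A_in[OF v, symmetric] .
  qed
  also have "\<dots> = (\<Sum>v\<in>W. e c v * (A s v * A v t)) + q * (\<Sum>v\<in>W. A s v * I v t) + q * (\<Sum>v\<in>W. I s v * A v t)
     + q\<^sup>2 * (\<Sum>v\<in>W. I s v * I v t) - r / q * ((\<Sum>v\<in>W. A s v) + (\<Sum>v\<in>W. A v t)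
     + q * (\<Sum>v\<in>W. I s v * e c v) + q * (\<Sum>v\<in>W. e c v * I v t)) + (r / q)\<^sup>2 * (\<Sum>v\<in>W. e c v)"
    unfolding sum.distrib sum_subtractf sum_distrib_left[symmetric] ..
  also have "(\<Sum>v\<in>W. A v t) = (\<Sum>v\<in>W. A t v)"
    using A_sym t W_D by (intro sum.cong refl) auto
  also have "(\<Sum>v\<in>W. e c v * (A s v * A v t)) = (\<Sum>v\<in>D. e c v * (A s v * A v t))"
  proof (intro sum.mono_neutral_left fin W_D ballI)
    fix v assume "v \<in> D - W"
    hence "e c v \<noteq> 1" using U_class[OF _ c, of v] by (auto simp: W_def)
    thus "e c v * (A s v * A v t) = 0" using e_01[of c v] by simp
  qed
  also have "(\<Sum>v\<in>W. e c v) = n" unfolding sum_W by (rule sum_Ue[OF c])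
  also have "(\<Sum>v\<in>W. A s v * I v t) = A s t"
    using W finite_W by (simp add: I_def if_distrib[of "\<lambda>x. _ * x"] cong: if_cong)
  also have "(\<Sum>v\<in>W. I s v * A v t) = A s t"
    using W finite_W by (simp add: I_def if_distrib[of "\<lambda>x. x * _"] cong: if_cong)
  also have "(\<Sum>v\<in>W. I s v * I v t) = I s t"
    using W finite_W by (simp add: I_def if_distrib[of "\<lambda>x. x * _"] cong: if_cong)
  also have "(\<Sum>v\<in>W. I s v * e c v) = 1"
    using W finite_W s by (simp add: I_def if_distrib[of "\<lambda>x. x * _"] cong: if_cong)
  also have "(\<Sum>v\<in>W. e c v * I v t) = 1"
    using W finite_W t by (simp add: I_def if_distrib[of "\<lambda>x. _ * x"] cong: if_cong)
  also have "(\<Sum>v\<in>W. A s v) = p" using sum_A_W W by blast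
  also have "(\<Sum>v\<in>W. A t v) = p" using sum_A_W W by blast
  finally have main: "(\<Sum>v\<in>D. e c v * (A s v * A v t)) =
    ?\<tau> * R s t - 2 * q * A s t - q\<^sup>2 * I s t + r / q * (2 * p + 2 * q) - (r / q)\<^sup>2 * n"
    using RR by (simp add: algebra_simps)
  have "(r / q)\<^sup>2 * n = r * (r * n) / q\<^sup>2" by (simp add: power2_eq_square)
  also have "\<dots> = r * (p + q) / q" using size q by (simp add: r_def power2_eq_square)
  finally have "r / q * (2 * p + 2 * q) - (r / q)\<^sup>2 * n = r * (p + q) / q"
    using q by (simp add: field_simps)
  moreover have "R s t = A s t + q * I s t - r / q" using R_W[OF W] K_class[OF s(1) c s(2), of t] t by simp
  ultimately show ?thesis using main by simp
qed

end

section \<open>The \<open>\<mu>\<close>-graphs\<close>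

context tight_antipodal_4
begin

text \<open>An eigenvector whose eigenvalue is not the valency has sum zero, so the equation
  \<open>(A - p I) (A + q I) = p J\<close> of the local graph restricts its eigenvalue to the two roots.\<close>

lemma local_eigenvalue:
  assumes x: "x \<in> V" and s: "s \<in> N x" "f s \<noteq> 0"
    and f: "\<And>s. s \<in> N x \<Longrightarrow> (\<Sum>t\<in>N x. A s t * f t) = \<eta> * f s" and \<eta>: "\<eta> \<noteq> p * (q + 1)"
  shows "\<eta> = p \<or> \<eta> = - q"
proof -
  have V: "t \<in> V" if "t \<in> N x" for t using that by (simp add: N_iff)
  have "\<eta> * (\<Sum>t\<in>N x. f t) = (\<Sum>s\<in>N x. \<Sum>t\<in>N x. A s t * f t)"
    using f by (simp add: sum_distrib_left)
  also have "\<dots> = (\<Sum>t\<in>N x. \<Sum>s\<in>N x. A s t * f t)" by (rule sum.swap)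
  also have "\<dots> = (\<Sum>t\<in>N x. (\<Sum>s\<in>N x. A t s) * f t)"
    using A_sym V by (intro sum.cong refl) (simp add: sum_distrib_right)
  also have "\<dots> = p * (q + 1) * (\<Sum>t\<in>N x. f t)"
    using local_valency[OF x] by (simp add: sum_distrib_left)
  finally have sum0: "(\<Sum>t\<in>N x. f t) = 0" using \<eta> by simp
  have "\<eta> * (\<eta> * f s) = (\<Sum>v\<in>N x. A s v * (\<eta> * f v))"
    unfolding f[OF s(1), symmetric] sum_distrib_left by (intro sum.cong refl) simp
  also have "\<dots> = (\<Sum>v\<in>N x. A s v * (\<Sum>t\<in>N x. A v t * f t))"
    using f by (intro sum.cong refl) simp
  also have "\<dots> = (\<Sum>v\<in>N x. \<Sum>t\<in>N x. A s v * A v t * f t)" by (simp add: sum_distrib_left mult.assoc)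
  also have "\<dots> = (\<Sum>t\<in>N x. \<Sum>v\<in>N x. A s v * A v t * f t)" by (rule sum.swap)
  also have "\<dots> = (\<Sum>t\<in>N x. ((p - q) * A s t + p * q * I s t + p) * f t)"
    using local_strongly_regular[OF x s(1)] by (simp flip: sum_distrib_right)
  also have "\<dots> = (p - q) * (\<Sum>t\<in>N x. A s t * f t) + p * q * (\<Sum>t\<in>N x. I s t * f t) + p * (\<Sum>t\<in>N x. f t)"
    unfolding sum_distrib_left sum.distrib[symmetric] by (intro sum.cong refl) (simp add: algebra_simps)
  also have "\<dots> = (p - q) * (\<eta> * f s) + p * q * f s"
    unfolding sum0 sum_I[OF finite_N s(1)] f[OF s(1)] by simp
  finally have "(\<eta> - p) * (\<eta> + q) * f s = 0" by (simp add: algebra_simps)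
  thus ?thesis using s(2) by (simp add: eq_neg_iff_add_eq_0)
qed

lemma split_local_graph_N:
  assumes x: "x \<in> V" and y: "y \<in> V" "d x y = 2"
  shows "split_local_graph (N x) (F y) A A p q c2"
proof
  have V: "t \<in> V" if "t \<in> N x" for t using that by (simp add: N_iff)
  show "finite (N x)" "finite (F y)" "1 < q" "0 \<le> p" using q_gt_1 p_nonneg by simp_all
  show "F y \<noteq> {}" using F_self[OF y(1)] by blast
  show "real (card (N x)) = q * (p * q + p + q)" using card_N[OF x] k_pq by (simp add: k_def)
  show "real (card (F y)) * c2 = q * (p + q)" using card_F[OF y(1)] r_c2 by simp
  fix s t y' y''
  show "A s t = 0 \<or> A s t = 1" by (simp add: A_def)
  {
    assume s: "s \<in> N x"
    show "A s s = 0" using d_eq_0[of s s] V[OF s] by (simp add: A_def)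
    show "(\<Sum>c\<in>F y. A c s) = 0 \<or> (\<Sum>c\<in>F y. A c s) = 1" using U_01[OF y(1) V[OF s]] by (simp add: U_def)
    show "(\<Sum>t\<in>N x. A s t) = p * (q + 1)" using local_valency[OF x s] .
    show "(\<Sum>t\<in>N x. A s t * A y' t) =
        p * A y' s + (p + q) / real (card (F y)) * (1 - (\<Sum>c\<in>F y. A c s))" if "y' \<in> F y"
      using mu_graph_equitable[OF x y that s] card_F[OF y(1)] by (simp add: U_def)
    assume t: "t \<in> N x"
    show "A s t = A t s" using A_sym V s t by simp
    show "(\<Sum>v\<in>N x. A s v * A v t) = (p - q) * A s t + p * q * (if s = t then 1 else 0) + p"
      using local_strongly_regular[OF x s t] by (simp add: I_def)
    assume y': "y' \<in> F y" "y'' \<in> F y" and st: "A y' s = 1" "A y'' t = 1" and ne: "y' \<noteq> y''"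
    show "A s t = 0"
    proof (rule ccontr)
      assume "A s t \<noteq> 0"
      hence d: "d s t = 1" "d y' s = 1" "d t y'' = 1"
        using st d_sym[OF F_V[OF y'(2)] V[OF t]] by (auto simp: A_def split: if_splits)
      have "d y' y'' \<le> d y' s + (d s t + d t y'')"
        using d_triangle[of y' s y''] d_triangle[of s t y''] y' V[OF s] V[OF t] F_V by fastforce
      thus False using d F_dist[OF y(1) y' ne] by simp
    qed
  }
  assume y': "y' \<in> F y" "y'' \<in> F y"
  show "(\<Sum>s\<in>N x. A y' s * A y'' s) = (if y' = y'' then c2 else 0)"
  proof (cases "y' = y''")
    case True
    have "(\<Sum>s\<in>N x. A y' s * A y' s) = (\<Sum>s\<in>N x. A y' s)" by (intro sum.cong refl) (simp add: A_def)
    thus ?thesis using sum_common_neighbours[OF x y y'(1)] True by simp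
  next
    case False
    hence "A y' s * A y'' s = 0" if "s \<in> N x" for s
      using fibre_neighbour_unique[OF y(1) y' V[OF that]] by (auto simp: A_def)
    hence "(\<Sum>s\<in>N x. A y' s * A y'' s) = 0" by (intro sum.neutral ballI)
    thus ?thesis using False by simp
  qed
qed

lemma fibre_size_bound: "real r * (p + q) \<le> p + q ^ 3"
proof -
  obtain x y where xy: "x \<in> V" "y \<in> V" "d x y = 2" using geodesic[of 2] by auto
  interpret L: split_local_graph "N x" "F y" A A p q c2 by (rule split_local_graph_N[OF xy])
  show ?thesis using L.r_bound card_F[OF xy(2)] by (simp add: L.r_def)
qed

lemma card_mu:
  assumes x: "x \<in> V" and y: "y \<in> V" "d x y = 2"
  shows "card (N x \<inter> N y) = c 2"
proof -
  have "N x \<inter> N y = {z \<in> V. d x z + 1 = d x y \<and> d y z = 1}" using y(2) by (auto simp: N_iff)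
  thus ?thesis using card_c[OF x y(1)] y(2) by simp
qed

lemma mu_valency:
  assumes x: "x \<in> V" and y: "y \<in> V" "d x y = 2" and s: "s \<in> N x" "s \<in> N y"
  shows "real (card (N x \<inter> N y \<inter> N s)) = p"
proof -
  have "A s t * A y t = (if t \<in> N y \<inter> N s then 1 else 0)" if "t \<in> N x" for t
    using that by (simp add: A_def N_iff)
  hence "(\<Sum>t\<in>N x. A s t * A y t) = (\<Sum>t\<in>N x. if t \<in> N y \<inter> N s then 1 else 0)"
    by (intro sum.cong refl)
  also have "\<dots> = real (card (N x \<inter> (N y \<inter> N s)))" by (subst sum.inter_restrict[symmetric]) auto
  finally have "real (card (N x \<inter> N y \<inter> N s)) = (\<Sum>t\<in>N x. A s t * A y t)" by (simp add: Int_assoc)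
  also have "\<dots> = p"
    using mu_graph_equitable[OF x y F_self[OF y(1)] s(1)] U_1[OF y(1) F_self[OF y(1)], of s] s
    by (simp add: A_def N_iff)
  finally show ?thesis .
qed

lemma mu_common_neighbours:
  assumes eq: "real r * (p + q) = p + q ^ 3" and x: "x \<in> V" and y: "y \<in> V" "d x y = 2"
    and s: "s \<in> N x" "s \<in> N y" and t: "t \<in> N x" "t \<in> N y" and ne: "s \<noteq> t"
  shows "real (card (N x \<inter> N y \<inter> N s \<inter> N t)) =
    (if d s t = 1 then (q - 1) * (q - 2) + 2 * (p - 1) / (q + 1) else (p + q ^ 3) / (q + 1))"
proof -
  interpret L: split_local_graph "N x" "F y" A A p q c2 by (rule split_local_graph_N[OF x y])
  have Lr: "L.r = real r" using card_F[OF y(1)] by (simp add: L.r_def)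
  have As: "A y s = 1" "A y t = 1" using s t by (simp_all add: A_def N_iff)
  have "A y v * (A s v * A v t) = (if v \<in> N y \<inter> N s \<inter> N t then 1 else 0)" if "v \<in> N x" for v
    using that d_sym[of v t] t by (simp add: A_def N_iff)
  hence "(\<Sum>v\<in>N x. A y v * (A s v * A v t)) = (\<Sum>v\<in>N x. if v \<in> N y \<inter> N s \<inter> N t then 1 else 0)"
    by (intro sum.cong refl)
  also have "\<dots> = real (card (N x \<inter> (N y \<inter> N s \<inter> N t)))" by (subst sum.inter_restrict[symmetric]) auto
  finally have "real (card (N x \<inter> N y \<inter> N s \<inter> N t)) = (\<Sum>v\<in>N x. A y v * (A s v * A v t))"
    by (simp add: Int_assoc)
  also have "\<dots> = (p + q) / (q + 1) * (A s t - r / q) - 2 * q * A s t + r * (p + q) / q"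
    using L.common_neighbours_at_equality[OF _ F_self[OF y(1)] s(1) As(1) t(1) As(2)] eq ne
    unfolding Lr by (simp add: L.I_def)
  also have "\<dots> = A s t * ((p + q) / (q + 1) - 2 * q) + r * (p + q) / (q + 1)"
  proof -
    define v z where "v = 1 / q" and "z = 1 / (q + 1)"
    have "q * v = 1" "(q + 1) * z = 1" using q_gt_1 by (simp_all add: v_def z_def)
    hence "(p + q) * z * (A s t - r * v) - 2 * q * A s t + r * (p + q) * v =
      A s t * ((p + q) * z - 2 * q) + r * (p + q) * z" by algebra
    thus ?thesis by (simp add: v_def z_def)
  qed
  also have "\<dots> = (if d s t = 1 then (q - 1) * (q - 2) + 2 * (p - 1) / (q + 1) else (p + q ^ 3) / (q + 1))"
  proof -
    define z where "z = 1 / (q + 1)"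
    have "(q + 1) * z = 1" using q_gt_1 by (simp add: z_def)
    hence "(p + q) * z - 2 * q + (p + q ^ 3) * z = (q - 1) * (q - 2) + 2 * (p - 1) * z" by algebra
    thus ?thesis unfolding eq by (simp add: A_def z_def)
  qed
  finally show ?thesis .
qed

text \<open>If the \<open>\<mu>\<close>-graphs are complete, the fourth parameter is not realised by a pair of vertices, but
  the arithmetic still makes it an integer.\<close>

lemma complete_mu_parameters:
  assumes eq: "real r * (p + q) = p + q ^ 3" and p: "p \<noteq> 0" and n: "c2 = p + 1"
  shows "(p + q ^ 3) / (q + 1) = (real r - 1)\<^sup>2 - 1"
proof -
  have 1: "real r * (p + 1) = q * (p + q)" using r_c2 n by simp
  have "(p + q ^ 3) * (p + 1) = q * (p + q) * (p + q)" unfolding eq[symmetric] 1[symmetric] by simp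
  hence "p * (q - 1) * (q\<^sup>2 - q - 1 - p) = 0" by algebra
  hence p_eq: "p = q\<^sup>2 - q - 1" using p q_gt_1 by simp
  have "real r * (q\<^sup>2 - 1) = (q + 1) * (q\<^sup>2 - 1)" using eq unfolding p_eq by algebra
  moreover have "q\<^sup>2 - 1 \<noteq> 0" using q_gt_1 by (simp add: power2_eq_1_iff)
  ultimately have "real r = q + 1" using mult_right_cancel by blast
  moreover have "p + q ^ 3 = (q + 1) * (q\<^sup>2 - 1)" unfolding p_eq by algebra
  ultimately show ?thesis using q_gt_1 by simp
qed

text \<open>The parameters are integers because they count common neighbours: \<open>\<mu>\<close>-graphs are nonempty, and
  contain an edge because \<open>p\<close> does not vanish.  Only for complete \<open>\<mu>\<close>-graphs does the last
  parameter need a separate argument.\<close>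

lemma mu_parameters:
  assumes eq: "real r * (p + q) = p + q ^ 3" and p: "p \<noteq> 0"
  obtains n' k' a' c' :: nat where
    "real n' = q * (p + q) / real r" "real k' = p" "real a' = (q - 1) * (q - 2) + 2 * (p - 1) / (q + 1)"
    "real c' = (p + q ^ 3) / (q + 1)"
    "\<And>x y. x \<in> V \<Longrightarrow> y \<in> V \<Longrightarrow> d x y = 2 \<Longrightarrow> card (N x \<inter> N y) = n'"
    "\<And>x y s. x \<in> V \<Longrightarrow> y \<in> V \<Longrightarrow> d x y = 2 \<Longrightarrow> s \<in> N x \<Longrightarrow> s \<in> N y \<Longrightarrow> card (N x \<inter> N y \<inter> N s) = k'"
    "\<And>x y s t. x \<in> V \<Longrightarrow> y \<in> V \<Longrightarrow> d x y = 2 \<Longrightarrow> s \<in> N x \<Longrightarrow> s \<in> N y \<Longrightarrow> t \<in> N x \<Longrightarrow> t \<in> N y \<Longrightarrow>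
      s \<noteq> t \<Longrightarrow> card (N x \<inter> N y \<inter> N s \<inter> N t) = (if d s t = 1 then a' else c')"
proof -
  obtain x y where xy: "x \<in> V" "y \<in> V" "d x y = 2" using geodesic[of 2] by auto
  let ?M = "N x \<inter> N y"
  have "card ?M \<noteq> 0" using card_mu[OF xy] c_pos[of 1] by (simp add: numeral_2_eq_2)
  then obtain s where s: "s \<in> N x" "s \<in> N y" by (metis Int_iff card.empty ex_in_conv)
  note k = mu_valency[OF xy s]
  have "card (?M \<inter> N s) \<noteq> 0" using k p by auto
  then obtain t where t: "t \<in> N x" "t \<in> N y" "t \<in> N s" by (metis Int_iff card.empty ex_in_conv)
  have st: "s \<noteq> t" "d s t = 1" using t(3) d_eq_0[of s t] s by (auto simp: N_iff)
  note a = mu_common_neighbours[OF eq xy s t(1,2) st(1), unfolded if_P[OF st(2)]]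
  have "\<exists>c'. real c' = (p + q ^ 3) / (q + 1)"
  proof (cases "\<exists>t\<in>?M. t \<noteq> s \<and> d s t \<noteq> 1")
    case True
    then obtain t where "t \<in> N x" "t \<in> N y" "s \<noteq> t" "d s t \<noteq> 1" by auto
    thus ?thesis using mu_common_neighbours[OF eq xy s, of t] by auto
  next
    case False
    hence "?M = insert s (?M \<inter> N s)" using s by (auto simp: N_iff)
    moreover have "s \<notin> N s" using d_eq_0[of s s] s by (auto simp: N_iff)
    ultimately have "card ?M = Suc (card (?M \<inter> N s))" by (metis Int_iff card_insert_disjoint finite_Int finite_N)
    hence "c2 = p + 1" using card_mu[OF xy] k by (simp add: c2_def)
    from complete_mu_parameters[OF eq p this]
    have "(p + q ^ 3) / (q + 1) = real ((r - 1)\<^sup>2 - 1)" using r_ge_2 by (simp add: of_nat_diff)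
    thus ?thesis by metis
  qed
  then obtain c' where c': "real c' = (p + q ^ 3) / (q + 1)" by blast
  show thesis
  proof (rule that[OF _ k a c' card_mu])
    show "real (c 2) = q * (p + q) / real r" using r_c2 r_ge_2 by (simp add: c2_def field_simps)
    show "card (N x' \<inter> N y' \<inter> N s') = card (?M \<inter> N s)"
      if "x' \<in> V" "y' \<in> V" "d x' y' = 2" "s' \<in> N x'" "s' \<in> N y'" for x' y' s'
      using mu_valency[OF that] k by simp
    show "card (N x' \<inter> N y' \<inter> N s' \<inter> N t') = (if d s' t' = 1 then card (?M \<inter> N s \<inter> N t) else c')"
      if "x' \<in> V" "y' \<in> V" "d x' y' = 2" "s' \<in> N x'" "s' \<in> N y'" "t' \<in> N x'" "t' \<in> N y'" "s' \<noteq> t'"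
      for x' y' s' t'
    proof -
      have "real (card (N x' \<inter> N y' \<inter> N s' \<inter> N t')) =
          real (if d s' t' = 1 then card (?M \<inter> N s \<inter> N t) else c')"
        using mu_common_neighbours[OF eq that] a c' by simp
      thus ?thesis by (simp only: of_nat_eq_iff)
    qed
  qed auto
qed

end

section \<open>From graphs to distances\<close>

lemma pair_graph_induced:
  assumes "pair_graph G" shows "pair_graph (induced_graph G S)"
proof -
  interpret pair_graph G by fact
  show ?thesis
    using pair_sym_arcs pair_no_loops pair_finite_verts pair_finite_arcs arc_fst_in_verts arc_snd_in_verts
    by unfold_locales (auto simp: induced_graph_def symmetric_def sym_def)
qed

text \<open>At distance \<open>0\<close> the truncated index \<open>i - 1\<close> in the definition of distance-regularity selects the
  vertex \<open>x\<close> itself, which is not its own neighbour, so the count agrees with the one in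
  \<open>card_c\<close>.\<close>

lemma AT4_metric:
  assumes "AT4 G p q r"
  obtains a b c \<theta> where "tight_antipodal_4 (pverts G) (gdist G) a b c r \<theta>"
proof -
  obtain a b c d k and \<theta> :: "nat \<Rightarrow> real" where
    dr: "distance_regular G a b c" and d: "d = diameter G" and k: "k = real (b 0)"
    and anti: "strict_antimono_on {..d} \<theta>" and ev: "eigenvalues G = \<theta> ` {..d}" and \<theta>0: "\<theta> 0 = k"
    and tight: "(\<theta> 1 + k / (real (a 1) + 1)) * (\<theta> d + k / (real (a 1) + 1)) =
          - (k * real (a 1) * real (b 1) / (real (a 1) + 1)\<^sup>2)"
    using assms unfolding AT4_def tight_def by blast
  have diam: "diameter G = 4" and cover: "antipodal_cover G r" using assms by (auto simp: AT4_def)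
  have d4: "d = 4" using d diam by simp
  interpret connected_pair_graph G
    using dr by (simp add: distance_regular_def connected_pair_graph_def connected_pair_graph_axioms_def)
  have inum: "card (at_dist G (gdist G x y) x \<inter> at_dist G 1 y) = a (gdist G x y)"
    "card (at_dist G (gdist G x y + 1) x \<inter> at_dist G 1 y) = b (gdist G x y)"
    "card (at_dist G (gdist G x y - 1) x \<inter> at_dist G 1 y) = c (gdist G x y)"
    if "x \<in> pverts G" "y \<in> pverts G" for x y
    using dr that gdist_le_diameter[OF that] unfolding distance_regular_def by blast+
  interpret M: antipodal_diameter_4 "pverts G" "gdist G" a b c r
  proof (unfold_locales)
    show "finite (pverts G)" by (rule pair_finite_verts)
    show "\<exists>x\<in>pverts G. \<exists>y\<in>pverts G. gdist G x y = 4" using diameter_attained diam by metis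
    fix x y assume x: "x \<in> pverts G" and y: "y \<in> pverts G"
    show "(gdist G x y = 0) = (x = y)" using gdist_eq_0 x y .
    show "gdist G x y = gdist G y x" using gdist_sym x y .
    show "gdist G x y \<le> 4" using gdist_le_diameter[OF x y] diam by simp
    show "\<exists>z\<in>pverts G. gdist G x z = 1 \<and> gdist G z y = n" if "gdist G x y = Suc n" for n
      using gdist_pred x y that .
    have "at_dist G (gdist G x y) x \<inter> at_dist G 1 y = {z \<in> pverts G. gdist G x z = gdist G x y \<and> gdist G y z = 1}"
      by (auto simp: at_dist_def)
    thus "card {z \<in> pverts G. gdist G x z = gdist G x y \<and> gdist G y z = 1} = a (gdist G x y)"
      using inum(1)[OF x y] by (simp only:)
    have "at_dist G (gdist G x y + 1) x \<inter> at_dist G 1 y =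
        {z \<in> pverts G. gdist G x z = gdist G x y + 1 \<and> gdist G y z = 1}"
      by (auto simp: at_dist_def)
    thus "card {z \<in> pverts G. gdist G x z = gdist G x y + 1 \<and> gdist G y z = 1} = b (gdist G x y)"
      using inum(2)[OF x y] by (simp only:)
    have "at_dist G (gdist G x y - 1) x \<inter> at_dist G 1 y =
        {z \<in> pverts G. gdist G x z + 1 = gdist G x y \<and> gdist G y z = 1}"
    proof (cases "x = y")
      case True
      hence "gdist G x y = 0" using gdist_eq_0 x y by simp
      thus ?thesis using True by (auto simp: at_dist_def)
    next
      case False
      hence "gdist G x y \<noteq> 0" using gdist_eq_0 x y by simp
      thus ?thesis by (auto simp: at_dist_def)
    qed
    thus "card {z \<in> pverts G. gdist G x z + 1 = gdist G x y \<and> gdist G y z = 1} = c (gdist G x y)"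
      using inum(3)[OF x y] by (simp only:)
    fix z assume z: "z \<in> pverts G"
    show "gdist G x z \<le> gdist G x y + gdist G y z" using gdist_triangle x y z .
    show "y = z \<or> gdist G y z = 4" if "gdist G x y = 4" "gdist G x z = 4"
      using cover x y z that unfolding antipodal_cover_def antipodal_def diam by blast
  next
    fix x assume x: "x \<in> pverts G"
    have "antipodal_rel G `` {x} \<in> pverts G // antipodal_rel G" by (rule quotientI[OF x])
    moreover have "antipodal_rel G `` {x} = {z \<in> pverts G. gdist G x z = 0 \<or> gdist G x z = 4}"
      using x diam by (auto simp: antipodal_rel_def)
    ultimately show "card {z \<in> pverts G. gdist G x z = 0 \<or> gdist G x z = 4} = r"
      using cover unfolding antipodal_cover_def by metis
  qed
  have "tight_antipodal_4 (pverts G) (gdist G) a b c r \<theta>"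
  proof (unfold_locales)
    show "\<theta> 0 > \<theta> 1" "\<theta> 1 > \<theta> 2" "\<theta> 2 > \<theta> 3" "\<theta> 3 > \<theta> 4"
      using anti unfolding d4 monotone_on_def by auto
    show "\<theta> 0 = real (b 0)" using \<theta>0 k by simp
    show "(\<theta> 1 + real (b 0) / (real (a 1) + 1)) * (\<theta> 4 + real (b 0) / (real (a 1) + 1)) =
      - (real (b 0) * real (a 1) * real (b 1) / (real (a 1) + 1)\<^sup>2)"
      using tight unfolding d4 k .
    fix i :: nat assume "i \<le> 4"
    hence "\<theta> i \<in> eigenvalues G" using ev d4 by auto
    then obtain f where f: "\<exists>x \<in> pverts G. f x \<noteq> 0"
      "\<And>x. x \<in> pverts G \<Longrightarrow> (\<Sum>y \<in> pverts G. adjacency G x y * f y) = \<theta> i * f x"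
      unfolding eigenvalues_def by blast
    have "(\<Sum>z\<in>M.N y. f z) = \<theta> i * f y" if y: "y \<in> pverts G" for y
    proof -
      have "(\<Sum>z\<in>M.N y. f z) = (\<Sum>z\<in>pverts G. if gdist G y z = 1 then f z else 0)"
        unfolding M.N_def by (rule sum.inter_filter[OF pair_finite_verts])
      also have "\<dots> = (\<Sum>z\<in>pverts G. adjacency G y z * f z)"
        by (intro sum.cong refl) (simp only: gdist_eq_1[OF y] adjacency_def, simp)
      finally show ?thesis using f(2)[OF y] by simp
    qed
    thus "\<exists>f. M.eigenfunction (\<theta> i) f \<and> (\<exists>x\<in>pverts G. f x \<noteq> 0)"
      using f(1) unfolding M.eigenfunction_def by blast
  qed
  thus thesis using that by blast
qed

theorem theorem3p2:
  fixes G :: "'a pair_pre_digraph" and p q :: real and r :: nat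
  assumes "AT4 G p q r"
  shows "real r \<le> (p + q ^ 3) / (p + q) \<and>
    (real r = (p + q ^ 3) / (p + q) \<longrightarrow>
      (\<exists>n k a c :: nat.
         real n = q * (p + q) / real r \<and>
         real k = p \<and>
         real a = (q - 1) * (q - 2) + 2 * (p - 1) / (q + 1) \<and>
         real c = (p + q ^ 3) / (q + 1) \<and>
         (\<forall>x \<in> pverts G. \<forall>y \<in> pverts G. gdist G x y = 2 \<longrightarrow>
            strongly_regular (mu_graph G x y) n k a c)))"
proof -
  obtain a b c \<theta> where T: "tight_antipodal_4 (pverts G) (gdist G) a b c r \<theta>"
    using AT4_metric[OF assms] by blast
  interpret T: tight_antipodal_4 "pverts G" "gdist G" a b c r \<theta> by (rule T)
  have dr: "\<exists>a b c. distance_regular G a b c" using assms unfolding AT4_def tight_def by blast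
  interpret connected_pair_graph G
    using dr by (auto simp: distance_regular_def connected_pair_graph_def connected_pair_graph_axioms_def)
  have pg: "pair_graph G" by unfold_locales
  have N: "at_dist G 1 x = T.N x" for x by (simp add: at_dist_def T.N_def)
  have arc: "(s, t) \<in> parcs G \<longleftrightarrow> gdist G s t = 1" if "s \<in> pverts G" "t \<in> pverts G" for s t
    using gdist_eq_1 that by simp
  \<comment> \<open>\<open>T.p\<close> and \<open>- T.q\<close> are the only possible local eigenvalues other than the valency
      \<open>T.p * (T.q + 1)\<close>.  If \<open>T.p\<close> were \<open>0\<close>, it would be equal to the valency, and a second
      nontrivial eigenvalue could not exist.\<close>
  have pq: "p = T.p \<and> q = T.q \<and> T.p \<noteq> 0"
  proof -
    obtain x where x: "x \<in> pverts G" using T.V_nonempty by blast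
    let ?L = "local_graph G x"
    have L: "pverts ?L = T.N x" "parcs ?L = parcs G \<inter> (T.N x \<times> T.N x)"
      unfolding local_graph_def induced_graph_def N by (auto simp: T.N_iff)
    obtain k where k: "regular_graph ?L k" "eigenvalues ?L - {real k} = {p, - q}"
      using assms x unfolding AT4_def nontrivial_eigenvalues_def by blast
    have adj: "adjacency ?L s t = T.A s t" if "s \<in> T.N x" "t \<in> T.N x" for s t
      using that arc[of s t] by (simp add: adjacency_def T.A_def L T.N_iff)
    have "card (T.N x) \<noteq> 0" using T.card_N[OF x] T.b_pos[of 0] by simp
    then obtain s where s: "s \<in> T.N x" by (metis card.empty ex_in_conv)
    have "real k = real (card {t \<in> T.N x. (s, t) \<in> parcs ?L})" using k(1) s by (simp add: regular_graph_def L)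
    also have "\<dots> = (\<Sum>t\<in>T.N x. if (s, t) \<in> parcs ?L then 1 else 0)"
      by (subst sum.inter_filter[symmetric]) auto
    also have "\<dots> = (\<Sum>t\<in>T.N x. T.A s t)" using adj[OF s] by (intro sum.cong) (auto simp: adjacency_def)
    finally have k_val: "real k = T.p * (T.q + 1)" using T.local_valency[OF x s] by simp
    have mem: "\<eta> = T.p \<or> \<eta> = - T.q" "\<eta> \<noteq> T.p * (T.q + 1)" if "\<eta> \<in> {p, - q}" for \<eta>
    proof -
      have \<eta>: "\<eta> \<in> eigenvalues ?L" "\<eta> \<noteq> T.p * (T.q + 1)" using that k(2) k_val by auto
      then obtain f where "\<exists>s\<in>T.N x. f s \<noteq> 0"
        "\<forall>s\<in>T.N x. (\<Sum>t\<in>T.N x. adjacency ?L s t * f t) = \<eta> * f s"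
        unfolding eigenvalues_def L by blast
      thus "\<eta> = T.p \<or> \<eta> = - T.q" using T.local_eigenvalue[OF x, of _ f \<eta>] adj \<eta>(2) by auto
      show "\<eta> \<noteq> T.p * (T.q + 1)" by (rule \<eta>(2))
    qed
    have "p > - q" using assms by (simp add: AT4_def)
    moreover have "T.p \<ge> 0" "T.q > 1" using T.p_nonneg T.q_gt_1 by auto
    ultimately show ?thesis using mem[of p] mem[of "- q"] by auto
  qed
  have pos: "p + q > 0" using pq T.p_nonneg T.q_gt_1 by simp
  have bound: "real r \<le> (p + q ^ 3) / (p + q)"
    using T.fibre_size_bound pos pq by (simp add: pos_le_divide_eq)
  show ?thesis
  proof (intro conjI impI bound)
    assume "real r = (p + q ^ 3) / (p + q)"
    hence eq: "real r * (T.p + T.q) = T.p + T.q ^ 3" using pos pq by simp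
    have p0: "T.p \<noteq> 0" using pq by simp
    show "\<exists>n k a c :: nat. real n = q * (p + q) / real r \<and> real k = p \<and>
         real a = (q - 1) * (q - 2) + 2 * (p - 1) / (q + 1) \<and> real c = (p + q ^ 3) / (q + 1) \<and>
         (\<forall>x \<in> pverts G. \<forall>y \<in> pverts G. gdist G x y = 2 \<longrightarrow> strongly_regular (mu_graph G x y) n k a c)"
    proof (rule T.mu_parameters[OF eq p0])
      fix n k a c :: nat
      assume par: "real n = T.q * (T.p + T.q) / real r" "real k = T.p"
          "real a = (T.q - 1) * (T.q - 2) + 2 * (T.p - 1) / (T.q + 1)" "real c = (T.p + T.q ^ 3) / (T.q + 1)"
        and n: "\<And>x y. x \<in> pverts G \<Longrightarrow> y \<in> pverts G \<Longrightarrow> gdist G x y = 2 \<Longrightarrow> card (T.N x \<inter> T.N y) = n"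
        and k: "\<And>x y s. x \<in> pverts G \<Longrightarrow> y \<in> pverts G \<Longrightarrow> gdist G x y = 2 \<Longrightarrow> s \<in> T.N x \<Longrightarrow> s \<in> T.N y \<Longrightarrow>
          card (T.N x \<inter> T.N y \<inter> T.N s) = k"
        and ac: "\<And>x y s t. x \<in> pverts G \<Longrightarrow> y \<in> pverts G \<Longrightarrow> gdist G x y = 2 \<Longrightarrow> s \<in> T.N x \<Longrightarrow> s \<in> T.N y \<Longrightarrow>
          t \<in> T.N x \<Longrightarrow> t \<in> T.N y \<Longrightarrow> s \<noteq> t \<Longrightarrow>
          card (T.N x \<inter> T.N y \<inter> T.N s \<inter> T.N t) = (if gdist G s t = 1 then a else c)"
      have "strongly_regular (mu_graph G x y) n k a c"
        if x: "x \<in> pverts G" and y: "y \<in> pverts G" and xy: "gdist G x y = 2" for x y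
      proof -
        let ?M = "mu_graph G x y" and ?S = "T.N x \<inter> T.N y"
        have V: "s \<in> pverts G" if "s \<in> ?S" for s using that by (simp add: T.N_iff)
        have M: "pverts ?M = ?S" "parcs ?M = parcs G \<inter> (?S \<times> ?S)"
          unfolding mu_graph_def induced_graph_def N by (auto simp: T.N_iff)
        have arcM: "(s, t) \<in> parcs ?M \<longleftrightarrow> gdist G s t = 1" if "s \<in> ?S" "t \<in> ?S" for s t
          using that arc[OF V[OF that(1)] V[OF that(2)]] by (simp add: M)
        have nb: "{t \<in> ?S. (s, t) \<in> parcs ?M} = ?S \<inter> T.N s" if "s \<in> ?S" for s
        proof -
          have "(s, t) \<in> parcs ?M \<longleftrightarrow> t \<in> T.N s" if t: "t \<in> ?S" for t
            unfolding arcM[OF \<open>s \<in> ?S\<close> t] T.N_iff using V[OF t] by simp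
          thus ?thesis by blast
        qed
        have nb2: "{v \<in> ?S. (s, v) \<in> parcs ?M \<and> (t, v) \<in> parcs ?M} = ?S \<inter> T.N s \<inter> T.N t"
          if "s \<in> ?S" "t \<in> ?S" for s t
          using nb[OF that(1)] nb[OF that(2)] by blast
        have "pair_graph ?M" unfolding mu_graph_def by (rule pair_graph_induced[OF pg])
        moreover have "card (pverts ?M) = n" using n[OF x y xy] by (simp add: M)
        moreover have "card {t \<in> pverts ?M. (s, t) \<in> parcs ?M} = k" if "s \<in> pverts ?M" for s
        proof -
          have s: "s \<in> ?S" using that by (simp only: M(1))
          thus ?thesis unfolding M(1) nb[OF s] using k[OF x y xy] by blast
        qed
        moreover have "card {v \<in> pverts ?M. (s, v) \<in> parcs ?M \<and> (t, v) \<in> parcs ?M} = (if (s, t) \<in> parcs ?M then a else c)"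
          if "s \<in> pverts ?M" "t \<in> pverts ?M" "s \<noteq> t" for s t
        proof -
          have st: "s \<in> ?S" "t \<in> ?S" using that(1,2) by (simp_all only: M(1))
          have "card (?S \<inter> T.N s \<inter> T.N t) = (if gdist G s t = 1 then a else c)"
            using ac[OF x y xy] st that(3) by blast
          thus ?thesis unfolding M(1) nb2[OF st] arcM[OF st] .
        qed
        moreover have "s \<noteq> t" if "(s, t) \<in> parcs ?M" for s t
          using that pair_no_loops[of "(s, t)"] by (simp add: M)
        ultimately show ?thesis unfolding strongly_regular_def regular_graph_def by simp
      qed
      thus ?thesis using par pq by blast
    qed
  qed
qed

end
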